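(* Let $F$ be an arbitrary field. Let $f:\mathbb{N}\rightarrow\mathbb{N}$ be a monotone, submultiplicative function such that there exists some $C>0$ for which $f(Cn)\geq n f(n)$ for all $n\in\mathbb{N}$. Then there exists a finitely generated, primitive monomial $F$-algebra with growth type equivalent to $f$.
   Context: $\mathbb{N}=\{1,2,3,\dots\}$. Monotone means monotone increasing, i.e. $f(n)\le f(n+1)$ for all $n$. A function $f:\mathbb{N}\to\mathbb{N}$ is submultiplicative if $f(m+n)\leq f(m)f(n)$ for all $m,n\in\mathbb{N}$. Constants such as $C$ (and $C,D$ below) may be taken to be positive integers, so that the expressions $f(Cn)$ make sense. A finitely generated monomial algebra over $F$ is a quotient $F\langle x_1,\dots,x_d\rangle/I$ of a free associative unital algebra on finitely many generators by an ideal $I$ generated by monomials (words in the $x_i$). For a finitely generated $F$-algebra $B$ with a finite-dimensional generating subspace $V$, the growth function is $n\mapsto \dim_F B(n)$, where $B(n)=F+V+V^2+\cdots+V^n$. Growth functions are considered up to the equivalence: $f\sim g$ if and only if there exist $C,D>0$ with $f(n)\leq g(Cn)\leq f(Dn)$ for all $n\in\mathbb{N}$. "Growth type equivalent to $f$" means that the growth function of the algebra is $\sim f$ (this does not depend on $V$). An algebra is (left) primitive if it admits a faithful simple left module. *)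

theory Defs
  imports "HOL-Algebra.Algebra"
begin

section \<open>Free associative algebras and monomial algebras\<close>

text \<open>
  The free associative unital algebra \<open>F\<langle>x\<^sub>0,\<dots>,x\<^sub>d\<^sub>-\<^sub>1\<rangle>\<close>. A word in the generators is a list over
  \<open>{..<d}\<close>, and an element of the algebra is the finitely supported family of its coefficients.
  The coefficient of \<open>w\<close> in a product is the sum over all factorisations of \<open>w\<close> into a prefix and
  a suffix.
\<close>

definition free_algebra :: "('a, 'b) ring_scheme \<Rightarrow> nat \<Rightarrow> (nat list \<Rightarrow> 'a) ring" where
  "free_algebra F d =
     \<lparr>carrier = {p. range p \<subseteq> carrier F \<and> finite {w. p w \<noteq> \<zero>\<^bsub>F\<^esub>} \<and>
                    {w. p w \<noteq> \<zero>\<^bsub>F\<^esub>} \<subseteq> lists {..<d}},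
      monoid.mult = (\<lambda>p q w. \<Oplus>\<^bsub>F\<^esub>i\<in>{..length w}. p (take i w) \<otimes>\<^bsub>F\<^esub> q (drop i w)),
      monoid.one = (\<lambda>w. if w = [] then \<one>\<^bsub>F\<^esub> else \<zero>\<^bsub>F\<^esub>),
      ring.zero = (\<lambda>w. \<zero>\<^bsub>F\<^esub>),
      ring.add = (\<lambda>p q w. p w \<oplus>\<^bsub>F\<^esub> q w)\<rparr>"

definition word_monomial :: "('a, 'b) ring_scheme \<Rightarrow> nat list \<Rightarrow> nat list \<Rightarrow> 'a" where
  "word_monomial F u = (\<lambda>w. if w = u then \<one>\<^bsub>F\<^esub> else \<zero>\<^bsub>F\<^esub>)"

text \<open>The set \<open>W\<close> of words may be infinite; \<^const>\<open>genideal\<close> yields two-sided ideals.\<close>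

definition monomial_ideal :: "('a, 'b) ring_scheme \<Rightarrow> nat \<Rightarrow> nat list set \<Rightarrow> (nat list \<Rightarrow> 'a) set" where
  "monomial_ideal F d W = Idl\<^bsub>free_algebra F d\<^esub> (word_monomial F ` W)"

definition monomial_algebra ::
    "('a, 'b) ring_scheme \<Rightarrow> nat \<Rightarrow> nat list set \<Rightarrow> (nat list \<Rightarrow> 'a) set ring" where
  "monomial_algebra F d W = free_algebra F d Quot monomial_ideal F d W"

text \<open>The canonical image of \<open>F\<close> in a monomial algebra, through which it is an \<open>F\<close>-algebra.\<close>

definition monomial_algebra_scalars ::
    "('a, 'b) ring_scheme \<Rightarrow> nat \<Rightarrow> nat list set \<Rightarrow> (nat list \<Rightarrow> 'a) set set" where
  "monomial_algebra_scalars F d W =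
     (\<lambda>c. monomial_ideal F d W +>\<^bsub>free_algebra F d\<^esub> (\<lambda>w. if w = [] then c else \<zero>\<^bsub>F\<^esub>)) ` carrier F"


section \<open>Primitive rings\<close>

text \<open>The library's locale \<^locale>\<open>module\<close> requires a commutative ring.\<close>

locale left_module = R?: ring R + M?: abelian_group M
  for R :: "('a, 'b) ring_scheme" (structure) and M :: "('a, 'c, 'd) module_scheme" (structure) +
  assumes smult_closed:
      "\<lbrakk>a \<in> carrier R; x \<in> carrier M\<rbrakk> \<Longrightarrow> a \<odot>\<^bsub>M\<^esub> x \<in> carrier M"
    and smult_l_distr:
      "\<lbrakk>a \<in> carrier R; b \<in> carrier R; x \<in> carrier M\<rbrakk> \<Longrightarrow>
        (a \<oplus>\<^bsub>R\<^esub> b) \<odot>\<^bsub>M\<^esub> x = a \<odot>\<^bsub>M\<^esub> x \<oplus>\<^bsub>M\<^esub> b \<odot>\<^bsub>M\<^esub> x"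
    and smult_r_distr:
      "\<lbrakk>a \<in> carrier R; x \<in> carrier M; y \<in> carrier M\<rbrakk> \<Longrightarrow>
        a \<odot>\<^bsub>M\<^esub> (x \<oplus>\<^bsub>M\<^esub> y) = a \<odot>\<^bsub>M\<^esub> x \<oplus>\<^bsub>M\<^esub> a \<odot>\<^bsub>M\<^esub> y"
    and smult_assoc:
      "\<lbrakk>a \<in> carrier R; b \<in> carrier R; x \<in> carrier M\<rbrakk> \<Longrightarrow>
        (a \<otimes>\<^bsub>R\<^esub> b) \<odot>\<^bsub>M\<^esub> x = a \<odot>\<^bsub>M\<^esub> (b \<odot>\<^bsub>M\<^esub> x)"
    and smult_one:
      "x \<in> carrier M \<Longrightarrow> \<one>\<^bsub>R\<^esub> \<odot>\<^bsub>M\<^esub> x = x"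

definition simple_left_module ::
    "('a, 'b) ring_scheme \<Rightarrow> ('a, 'c, 'd) module_scheme \<Rightarrow> bool" where
  "simple_left_module R M \<longleftrightarrow> left_module R M \<and> carrier M \<noteq> {\<zero>\<^bsub>M\<^esub>} \<and>
     (\<forall>N. submodule N R M \<longrightarrow> N = {\<zero>\<^bsub>M\<^esub>} \<or> N = carrier M)"

definition faithful_left_module ::
    "('a, 'b) ring_scheme \<Rightarrow> ('a, 'c, 'd) module_scheme \<Rightarrow> bool" where
  "faithful_left_module R M \<longleftrightarrow> left_module R M \<and>
     (\<forall>a\<in>carrier R. (\<forall>x\<in>carrier M. a \<odot>\<^bsub>M\<^esub> x = \<zero>\<^bsub>M\<^esub>) \<longrightarrow> a = \<zero>\<^bsub>R\<^esub>)"

text \<open>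
  Modules with elements of type \<^typ>\<open>'a set\<close> suffice: a simple left module is isomorphic to \<open>R/L\<close>
  for a maximal left ideal \<open>L\<close>, and the elements of \<open>R/L\<close> are cosets, i.e. sets of elements of \<open>R\<close>.
\<close>

definition left_primitive :: "('a, 'b) ring_scheme \<Rightarrow> bool" where
  "left_primitive R \<longleftrightarrow>
     (\<exists>M :: ('a, 'a set) module. simple_left_module R M \<and> faithful_left_module R M)"


section \<open>Growth\<close>

text \<open>
  Here a nonzero algebra over a field is a ring \<open>B\<close> together with the central subfield \<open>K\<close> that is
  the image of the base field, so that linear algebra over \<open>K\<close> is that of
  \<^theory>\<open>HOL-Algebra.Embedded_Algebras\<close>. The locale \<^locale>\<open>subalgebra\<close> of that theory describes the
  \<open>K\<close>-linear subspaces, with no closure under multiplication.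
\<close>

definition fd_generating_subspace :: "('a, 'b) ring_scheme \<Rightarrow> 'a set \<Rightarrow> 'a set \<Rightarrow> bool" where
  "fd_generating_subspace B K V \<longleftrightarrow>
     subalgebra K V B \<and> ring.finite_dimension B K V \<and> generate_ring B (K \<union> V) = carrier B"

text \<open>
  \<open>V\<^sup>n\<close>, the span of all products of \<open>n\<close> elements of \<open>V\<close>. As \<open>V\<close> is closed under \<open>K\<close>, the additive
  subgroup generated by the products is already the \<open>K\<close>-span.
\<close>

primrec subspace_power :: "('a, 'b) ring_scheme \<Rightarrow> 'a set \<Rightarrow> 'a set \<Rightarrow> nat \<Rightarrow> 'a set" where
  "subspace_power B K V 0 = K"
| "subspace_power B K V (Suc n) = generate (add_monoid B) (subspace_power B K V n <#>\<^bsub>B\<^esub> V)"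

text \<open>\<open>B(n) = K + V + V\<^sup>2 + \<dots> + V\<^sup>n\<close>\<close>

primrec growth_space :: "('a, 'b) ring_scheme \<Rightarrow> 'a set \<Rightarrow> 'a set \<Rightarrow> nat \<Rightarrow> 'a set" where
  "growth_space B K V 0 = K"
| "growth_space B K V (Suc n) = growth_space B K V n <+>\<^bsub>B\<^esub> subspace_power B K V (Suc n)"

definition growth_function :: "('a, 'b) ring_scheme \<Rightarrow> 'a set \<Rightarrow> 'a set \<Rightarrow> nat \<Rightarrow> nat" where
  "growth_function B K V n = ring.dim B K (growth_space B K V n)"

text \<open>
  Functions on the positive integers are represented by functions on \<^typ>\<open>nat\<close> whose value at \<open>0\<close>
  is irrelevant.
\<close>

definition growth_equiv :: "(nat \<Rightarrow> nat) \<Rightarrow> (nat \<Rightarrow> nat) \<Rightarrow> bool" where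
  "growth_equiv f g \<longleftrightarrow>
     (\<exists>C\<ge>1. \<exists>D\<ge>1. \<forall>n\<ge>1. f n \<le> g (C * n) \<and> g (C * n) \<le> f (D * n))"

text \<open>
  The growth type does not depend on the generating subspace, so all of them are required to give
  growth equivalent to \<open>f\<close>; the first conjunct says that \<open>B\<close> is finitely generated.
\<close>

definition has_growth_type :: "('a, 'b) ring_scheme \<Rightarrow> 'a set \<Rightarrow> (nat \<Rightarrow> nat) \<Rightarrow> bool" where
  "has_growth_type B K f \<longleftrightarrow>
     (\<exists>V. fd_generating_subspace B K V) \<and>
     (\<forall>V. fd_generating_subspace B K V \<longrightarrow> growth_equiv (growth_function B K V) f)"

end

theory Submission
  imports Defs "HOL-Library.Sublist" "HOL-Library.Nat_Bijection"
begin

text \<open>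
  For a factor-closed language \<open>L\<close> let \<open>A\<close> be the monomial algebra whose nonzero words are those of
  \<open>L\<close>; then \<open>dim A(n)\<close> counts the words of \<open>L\<close> of length at most \<open>n\<close>.

  If \<open>L\<close> is uniformly recurrent and has unbounded complexity, then \<open>A\<close> is primitive. Indeed, distinct
  words of \<open>L\<close> have distinct contexts, so that every nonzero ideal contains a word of \<open>L\<close>, hence, by
  recurrence, all long words, hence a power of the sum \<open>b\<close> of the letters. On the other hand
  \<open>A(1 - b) \<noteq> A\<close>, since the only possible left inverse of \<open>1 - b\<close> is the infinite sum of all words of
  \<open>L\<close>. A maximal left ideal containing \<open>1 - b\<close> contains no power of \<open>b\<close>, so its quotient is a
  faithful simple module.

  The language consists of the factors of blocks of length \<open>2\<^sup>k\<close>, where a block of level \<open>k + 1\<close> is a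
  product of two blocks of level \<open>k\<close>, the left one restricted to a subset \<open>C\<^sub>k\<close> whose size is prescribed
  by \<open>f\<close>. There are about \<open>2\<^sup>k f(2\<^sup>k)\<close> blocks of level \<open>k\<close>. The polynomial factors are harmless because
  \<open>f(C n) \<ge> n f(n)\<close>, and they leave enough room to let all elements of \<open>C\<^sub>k\<close> end with a given short block,
  which makes \<open>L\<close> uniformly recurrent.
\<close>

section \<open>Primitivity from a maximal left ideal\<close>

text \<open>Being a commutative group depends on three fields of the record only. This carries the
  commutative group structure of the additive factor group over to the additive monoid of a module
  record.\<close>

lemma comm_group_cong:
  assumes "comm_group G" "carrier H = carrier G" "monoid.mult H = monoid.mult G"
    "monoid.one H = monoid.one G"
  shows "comm_group H"
  using assms(1)
  unfolding comm_group_def group_def group_axioms_def comm_monoid_def comm_monoid_axioms_def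
    Group.monoid_def Units_def assms(2-4) .

section \<open>Quotients of a ring by a left ideal\<close>

locale left_ideal = additive_subgroup J R + ring R for J and R (structure) +
  assumes l_closed: "\<lbrakk>a \<in> carrier R; x \<in> J\<rbrakk> \<Longrightarrow> a \<otimes> x \<in> J"

sublocale left_ideal \<subseteq> abelian_subgroup J R
proof (intro abelian_subgroupI3 abelian_group.intro)
  show "abelian_group_axioms R"
    using abelian_group_def is_abelian_group by blast
qed (simp_all add: is_additive_subgroup abelian_monoid_axioms)

text \<open>The module \<open>R/J\<close>. The scalar product is the union over all representatives,
  so that none has to be chosen; \<open>left_quotient_smult\<close> shows that the union is a single
  coset.\<close>

definition left_quotient_module :: "('a, 'b) ring_scheme \<Rightarrow> 'a set \<Rightarrow> ('a, 'a set) module" where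
  "left_quotient_module R J =
    \<lparr>carrier = a_rcosets\<^bsub>R\<^esub> J, monoid.mult = undefined, monoid.one = undefined, ring.zero = J, ring.add = set_add R,
     smult = (\<lambda>r Z. \<Union>x\<in>Z. J +>\<^bsub>R\<^esub> (r \<otimes>\<^bsub>R\<^esub> x))\<rparr>"

context left_ideal
begin

text \<open>Two representatives of a coset differ by some \<open>h\<close> in \<open>J\<close>, and
  \<open>r \<otimes> h\<close> stays in \<open>J\<close> because \<open>J\<close> is a left ideal.
  All sets in the union therefore coincide.\<close>

lemma left_quotient_smult:
  assumes r: "r \<in> carrier R" and x: "x \<in> carrier R"
  shows "r \<odot>\<^bsub>left_quotient_module R J\<^esub> (J +> x) = J +> (r \<otimes> x)"
proof -
  have eq: "J +> (r \<otimes> y) = J +> (r \<otimes> x)" if y: "y \<in> J +> x" for y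
  proof -
    obtain h where h: "h \<in> J" "y = h \<oplus> x"
      using y by (auto simp: a_r_coset_def')
    have "r \<otimes> y = r \<otimes> h \<oplus> r \<otimes> x"
      using h r x by (simp add: r_distr a_Hcarr)
    moreover have "r \<otimes> h \<in> J"
      using l_closed r h by blast
    ultimately have "r \<otimes> y \<in> J +> (r \<otimes> x)"
      by (auto simp: a_r_coset_def')
    then show ?thesis
      using a_repr_independence[of "r \<otimes> y" J "r \<otimes> x"] r x a_subgroup by simp
  qed
  have "(\<Union>y\<in>J +> x. J +> (r \<otimes> y)) = (\<Union>y\<in>J +> x. J +> (r \<otimes> x))"
    by (intro SUP_cong refl eq)
  also have "\<dots> = J +> (r \<otimes> x)"
    using a_rcos_self[OF x] by blast
  finally show ?thesis
    unfolding left_quotient_module_def by simp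
qed

lemma left_module_quotient: "left_module R (left_quotient_module R J)"
proof (rule left_module.intro)
  show "ring R" by (rule ring_axioms)
  show "abelian_group (left_quotient_module R J)"
    by (rule comm_group_abelian_groupI)
      (rule comm_group_cong[OF a_factorgroup_is_comm_group],
        simp_all add: left_quotient_module_def A_FactGroup_def')
  have carr: "Z \<in> carrier (left_quotient_module R J) \<longleftrightarrow> (\<exists>x\<in>carrier R. Z = J +> x)" for Z
    by (auto simp: left_quotient_module_def A_RCOSETS_defs a_r_coset_def[symmetric])
  have add: "(J +> x) \<oplus>\<^bsub>left_quotient_module R J\<^esub> (J +> y) = J +> (x \<oplus> y)"
    if "x \<in> carrier R" "y \<in> carrier R" for x y
    using that by (simp add: left_quotient_module_def a_rcos_sum)
  show "left_module_axioms R (left_quotient_module R J)"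
  proof (rule left_module_axioms.intro)
    fix a y assume "a \<in> carrier R" "y \<in> carrier (left_quotient_module R J)"
    then show "a \<odot>\<^bsub>left_quotient_module R J\<^esub> y \<in> carrier (left_quotient_module R J)"
      unfolding carr by (metis left_quotient_smult m_closed)
  qed (unfold carr, auto simp: left_quotient_smult add l_distr r_distr m_assoc)
qed

text \<open>The preimage \<open>?J'\<close> in \<open>R\<close> of a submodule \<open>N\<close> is a
  left ideal above \<open>J\<close>. If it contains \<open>\<one>\<close>, then \<open>N\<close> is
  everything; otherwise maximality makes it \<open>J\<close>, and \<open>N\<close> is zero.\<close>

lemma simple_left_quotient:
  assumes one: "\<one> \<notin> J"
    and maximal: "\<And>J'. \<lbrakk>left_ideal J' R; J \<subseteq> J'; \<one> \<notin> J'\<rbrakk> \<Longrightarrow> J' = J"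
  shows "simple_left_module R (left_quotient_module R J)"
  unfolding simple_left_module_def
proof (intro conjI allI impI)
  let ?M = "left_quotient_module R J"
  interpret M: left_module R ?M by (rule left_module_quotient)
  have carr: "Z \<in> carrier ?M \<longleftrightarrow> (\<exists>x\<in>carrier R. Z = J +> x)" for Z
    by (auto simp: left_quotient_module_def A_RCOSETS_defs a_r_coset_def[symmetric])
  have add: "(J +> x) \<oplus>\<^bsub>?M\<^esub> (J +> y) = J +> (x \<oplus> y)" if "x \<in> carrier R" "y \<in> carrier R" for x y
    using that by (simp add: left_quotient_module_def a_rcos_sum)
  have zero: "\<zero>\<^bsub>?M\<^esub> = J" by (simp add: left_quotient_module_def)
  have eqJ: "J +> x = J \<longleftrightarrow> x \<in> J" if "x \<in> carrier R" for x
    using that a_rcos_self a_rcos_const by metis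
  show "left_module R ?M" by (rule left_module_quotient)
  show "carrier ?M \<noteq> {\<zero>\<^bsub>?M\<^esub>}"
  proof -
    have "J +> \<one> \<in> carrier ?M" unfolding carr by blast
    moreover have "J +> \<one> \<noteq> J" using eqJ one by blast
    ultimately show ?thesis unfolding zero by blast
  qed
  fix N assume N: "submodule N R ?M"
  interpret N: submodule N R ?M by (rule N)
  let ?J' = "{x \<in> carrier R. J +> x \<in> N}"
  have closed: "J +> (x \<oplus> y) \<in> N" if "x \<in> carrier R" "y \<in> carrier R" "J +> x \<in> N" "J +> y \<in> N" for x y
    using N.m_closed[of "J +> x" "J +> y"] that add by simp
  have smult: "J +> (r \<otimes> x) \<in> N" if "r \<in> carrier R" "x \<in> carrier R" "J +> x \<in> N" for r x
    using N.smult_closed[of r "J +> x"] that left_quotient_smult by simp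
  have J': "left_ideal ?J' R"
  proof (intro left_ideal.intro additive_subgroup.intro left_ideal_axioms.intro)
    show "subgroup ?J' (add_monoid R)"
    proof (rule add.subgroupI)
      show "?J' \<noteq> {}"
      proof -
        have "J +> \<zero> = \<zero>\<^bsub>?M\<^esub>" using zero eqJ[of \<zero>] by simp
        then have "\<zero> \<in> ?J'" using N.one_closed by simp
        then show ?thesis by blast
      qed
      show "\<ominus> x \<in> ?J'" if "x \<in> ?J'" for x
        using smult[of "\<ominus> \<one>" x] that by (simp add: l_minus)
    qed (auto simp: closed)
  qed (auto simp: ring_axioms smult)
  have sub: "J \<subseteq> ?J'"
  proof
    fix x assume x: "x \<in> J"
    then have "J +> x = \<zero>\<^bsub>?M\<^esub>" using a_rcos_const zero by simp
    then show "x \<in> ?J'" using N.one_closed x by simp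
  qed
  show "N = {\<zero>\<^bsub>?M\<^esub>} \<or> N = carrier ?M"
  proof (cases "\<one> \<in> ?J'")
    case True
    then have "J +> (x \<otimes> \<one>) \<in> N" if "x \<in> carrier R" for x
      using that by (intro smult) blast+
    then have "J +> x \<in> N" if "x \<in> carrier R" for x
      using that by (metis r_one)
    then have "carrier ?M \<subseteq> N" unfolding subset_iff carr by blast
    then show ?thesis using N.subset by auto
  next
    case False
    then have "?J' = J" using maximal[OF J' sub] by blast
    moreover have "\<exists>x\<in>carrier R. Z = J +> x" if "Z \<in> N" for Z
      using N.subset that unfolding carr[symmetric] by auto
    ultimately have "Z = J" if "Z \<in> N" for Z
      using eqJ that by blast
    then have "N \<subseteq> {J}" by blast
    then show ?thesis using N.one_closed zero by auto
  qed
qed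

end

section \<open>A criterion for primitivity\<close>

text \<open>Telescoping: the difference to the previous power is
  \<open>b [^] n \<otimes> (\<one> \<ominus> b)\<close>, a left multiple of an element of
  \<open>J\<close>.\<close>

lemma (in ring) one_minus_pow_in_left_ideal:
  assumes "left_ideal J R" and b: "b \<in> carrier R" and "\<one> \<ominus> b \<in> J"
  shows "\<one> \<ominus> b [^] (n::nat) \<in> J"
proof -
  interpret left_ideal J R by fact
  show ?thesis
  proof (induction n)
    case 0
    then show ?case by (simp add: r_neg a_minus_def)
  next
    case (Suc n)
    have bn: "b [^] n \<in> carrier R" using b by simp
    have "\<one> \<ominus> b [^] Suc n = (\<one> \<ominus> b [^] n) \<oplus> b [^] n \<otimes> (\<one> \<ominus> b)"
      using b bn by (simp add: a_minus_def r_distr r_minus a_assoc r_neg1)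
    then show ?case
      using Suc l_closed[OF bn assms(3)] by simp
  qed
qed

text \<open>Let \<open>J\<close> be a maximal left ideal containing
  \<open>\<one> \<ominus> b\<close>. A nonzero annihilator of \<open>R/J\<close> would be a
  two-sided ideal containing some power of \<open>b\<close>. That power would lie in
  \<open>J\<close>, as does its difference to \<open>\<one>\<close>, so that \<open>J\<close> would
  contain \<open>\<one>\<close>.\<close>

theorem (in ring) left_primitiveI:
  assumes b: "b \<in> carrier R"
    and not_inv: "\<And>a. a \<in> carrier R \<Longrightarrow> a \<otimes> (\<one> \<ominus> b) \<noteq> \<one>"
    and pow: "\<And>P. \<lbrakk>ideal P R; P \<noteq> {\<zero>}\<rbrakk> \<Longrightarrow> \<exists>n::nat. b [^] n \<in> P"
  shows "left_primitive R"
proof -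
  define \<A> where "\<A> = {J. left_ideal J R \<and> \<one> \<ominus> b \<in> J \<and> \<one> \<notin> J}"
  define c where "c = \<one> \<ominus> b"
  have c: "c \<in> carrier R" using b by (simp add: c_def)
  \<comment> \<open>The left ideal generated by \<open>\<one> \<ominus> b\<close>. It is proper by
    \<open>not_inv\<close> and starts the application of Zorn's lemma.\<close>
  define J0 where "J0 = (\<lambda>a. a \<otimes> c) ` carrier R"
  have "left_ideal J0 R"
  proof (intro left_ideal.intro additive_subgroup.intro left_ideal_axioms.intro)
    show "subgroup J0 (add_monoid R)"
    proof (rule add.subgroupI)
      show "J0 \<subseteq> carrier R" "J0 \<noteq> {}" using c by (auto simp: J0_def)
      show "\<ominus> x \<in> J0" if "x \<in> J0" for x
        using that c l_minus[symmetric] by (auto simp: J0_def)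
      show "x \<oplus> y \<in> J0" if "x \<in> J0" "y \<in> J0" for x y
        using that c l_distr[symmetric] by (auto simp: J0_def)
    qed
    show "r \<otimes> x \<in> J0" if "r \<in> carrier R" "x \<in> J0" for r x
      using that c m_assoc[symmetric] by (auto simp: J0_def)
  qed (rule ring_axioms)
  moreover have "\<one> \<ominus> b \<in> J0"
    unfolding J0_def c_def[symmetric] using c l_one[OF c] by (metis image_eqI one_closed)
  moreover have "\<one> \<notin> J0"
  proof
    assume "\<one> \<in> J0"
    then obtain a where a: "a \<in> carrier R" "a \<otimes> c = \<one>"
      unfolding J0_def by (elim imageE) simp
    with not_inv[OF a(1)] show False unfolding c_def by simp
  qed
  ultimately have "J0 \<in> \<A>" unfolding \<A>_def by blast
  then have "\<A> \<noteq> {}" by blast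
  moreover have "\<Union>\<C> \<in> \<A>" if C: "\<C> \<noteq> {}" "subset.chain \<A> \<C>" for \<C>
  proof -
    have sub: "\<C> \<subseteq> \<A>" and lin: "\<And>Z Y. Z \<in> \<C> \<Longrightarrow> Y \<in> \<C> \<Longrightarrow> Z \<subseteq> Y \<or> Y \<subseteq> Z"
      using C(2) unfolding subset_chain_def by blast+
    have li: "left_ideal Z R" if "Z \<in> \<C>" for Z using sub that unfolding \<A>_def by blast
    have sg: "subgroup Z (add_monoid R)" if "Z \<in> \<C>" for Z
      using li[OF that] by (simp add: additive_subgroup.a_subgroup left_ideal.axioms(1))
    have "left_ideal (\<Union>\<C>) R"
    proof (intro left_ideal.intro additive_subgroup.intro left_ideal_axioms.intro)
      show "subgroup (\<Union>\<C>) (add_monoid R)"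
      proof (rule add.subgroupI)
        show "\<Union>\<C> \<subseteq> carrier R" using subgroup.subset[OF sg] by fastforce
        show "\<Union>\<C> \<noteq> {}" using C(1) subgroup.one_closed[OF sg] by fastforce
        show "\<ominus> x \<in> \<Union>\<C>" if "x \<in> \<Union>\<C>" for x
          using that add.subgroupE(3)[OF sg] by (auto simp: a_inv_def)
        show "x \<oplus> y \<in> \<Union>\<C>" if xy: "x \<in> \<Union>\<C>" "y \<in> \<Union>\<C>" for x y
        proof -
          obtain Z Y where Z: "Z \<in> \<C>" "x \<in> Z" and Y: "Y \<in> \<C>" "y \<in> Y" using xy by blast
          obtain U where "U \<in> \<C>" "x \<in> U" "y \<in> U"
            using lin[OF Z(1) Y(1)] Z Y by blast
          then show ?thesis using add.subgroupE(4)[OF sg] by auto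
        qed
      qed
      show "a \<otimes> x \<in> \<Union>\<C>" if "a \<in> carrier R" "x \<in> \<Union>\<C>" for a x
        using that left_ideal.l_closed[OF li] by blast
    qed (rule ring_axioms)
    then show ?thesis using sub C(1) unfolding \<A>_def by blast
  qed
  ultimately obtain J where J: "J \<in> \<A>" and maxJ: "\<And>Z. Z \<in> \<A> \<Longrightarrow> J \<subseteq> Z \<Longrightarrow> Z = J"
    using subset_Zorn_nonempty[of \<A>] by metis
  have bJ: "\<one> \<ominus> b \<in> J" and oneJ: "\<one> \<notin> J" using J unfolding \<A>_def by blast+
  interpret J: left_ideal J R using J unfolding \<A>_def by blast
  let ?M = "left_quotient_module R J"
  have simple: "simple_left_module R ?M"
  proof (rule J.simple_left_quotient[OF oneJ])
    show "J' = J" if "left_ideal J' R" "J \<subseteq> J'" "\<one> \<notin> J'" for J'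
      using that bJ by (intro maxJ) (unfold \<A>_def, blast+)
  qed
  have "a = \<zero>" if a: "a \<in> carrier R" "\<And>x. x \<in> carrier ?M \<Longrightarrow> a \<odot>\<^bsub>?M\<^esub> x = \<zero>\<^bsub>?M\<^esub>" for a
  proof (rule ccontr)
    assume "a \<noteq> \<zero>"
    \<comment> \<open>The annihilator of \<open>R/J\<close>, which is a two-sided ideal although
      \<open>J\<close> is only a left ideal.\<close>
    define P where "P = {r \<in> carrier R. \<forall>x\<in>carrier R. r \<otimes> x \<in> J}"
    have "ideal P R"
    proof (rule idealI[OF ring_axioms])
      show "subgroup P (add_monoid R)"
        by (rule add.subgroupI)
          (auto simp: P_def l_distr l_minus intro!: exI[of _ \<zero>] J.a_closed J.a_inv_closed)
    qed (auto simp: P_def m_assoc J.l_closed)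
    moreover have "a \<in> P"
    proof -
      have "a \<otimes> x \<in> J" if x: "x \<in> carrier R" for x
      proof -
        have "J +> x \<in> carrier ?M"
          using x by (auto simp: left_quotient_module_def A_RCOSETS_defs a_r_coset_def[symmetric])
        then have "J +> (a \<otimes> x) = J"
          using a J.left_quotient_smult[OF a(1) x] by (simp add: left_quotient_module_def)
        then show ?thesis using J.a_rcos_self[of "a \<otimes> x"] a x by simp
      qed
      then show ?thesis using a unfolding P_def by blast
    qed
    ultimately obtain n :: nat where "b [^] n \<in> P"
      using pow \<open>a \<noteq> \<zero>\<close> by blast
    then have bn: "b [^] n \<in> J"
      unfolding P_def using b by (auto dest: bspec[of _ _ \<one>])
    have "(\<one> \<ominus> b [^] n) \<oplus> b [^] n \<in> J"
      using one_minus_pow_in_left_ideal[OF J.left_ideal_axioms b bJ] bn by (rule J.a_closed)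
    then show False
      using oneJ b by (simp add: a_minus_def a_assoc l_neg)
  qed
  then have "faithful_left_module R ?M"
    unfolding faithful_left_module_def using J.left_module_quotient by blast
  with simple show ?thesis unfolding left_primitive_def by blast
qed

section \<open>Recurrent languages\<close>

text \<open>These are the words that survive in a monomial algebra: killing a word kills all words
  that contain it. The empty word belongs to \<open>L\<close> so that the algebra is
  nonzero.\<close>

locale factorial_language =
  fixes d :: nat and L :: "nat list set"
  assumes L_lists: "L \<subseteq> lists {..<d}"
    and Nil_in_L: "[] \<in> L"
    and factor_closed: "\<lbrakk>w \<in> L; sublist u w\<rbrakk> \<Longrightarrow> u \<in> L"
begin

lemma finite_length: "finite {w \<in> L. length w = n}"
  by (rule finite_subset[OF _ finite_lists_length_eq[of "{..<d}" n]]) (use L_lists in auto)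

lemma finite_length_le: "finite {w \<in> L. length w \<le> n}"
  by (rule finite_subset[OF _ finite_lists_length_le[of "{..<d}" n]]) (use L_lists in auto)

text \<open>The syntactic congruence of \<open>L\<close>.\<close>

definition same_contexts :: "nat list \<Rightarrow> nat list \<Rightarrow> bool" where
  "same_contexts u v \<longleftrightarrow> (\<forall>l r. l @ u @ r \<in> L \<longleftrightarrow> l @ v @ r \<in> L)"

lemma same_contexts_trans: "same_contexts u v \<Longrightarrow> same_contexts v w \<Longrightarrow> same_contexts u w"
  unfolding same_contexts_def by blast

lemma same_contexts_append: "same_contexts u v \<Longrightarrow> same_contexts (l @ u @ r) (l @ v @ r)"
  unfolding same_contexts_def by (metis append.assoc)

end

text \<open>Uniform recurrence together with unbounded complexity. The latter excludes the factors
  of a periodic word, of which there are boundedly many of each length.\<close>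

locale recurrent_language = factorial_language +
  assumes recurrent: "u \<in> L \<Longrightarrow> \<exists>N. \<forall>w\<in>L. N \<le> length w \<longrightarrow> sublist u w"
    and unbounded: "\<exists>n. B < card {w \<in> L. length w = n}"
begin

lemma ex_long: "\<exists>w\<in>L. M \<le> length w"
proof (rule ccontr)
  assume "\<not> ?thesis"
  then have "{w \<in> L. length w = n} \<subseteq> {w \<in> L. length w \<le> M}" for n by fastforce
  then have "card {w \<in> L. length w = n} \<le> card {w \<in> L. length w \<le> M}" for n
    by (intro card_mono finite_length_le)
  then show False using unbounded[of "card {w \<in> L. length w \<le> M}"] by (meson not_le)
qed

section \<open>Absence of periodicity and separation of words by contexts\<close>

lemma nth_concat_replicate:
  "j < k * length q \<Longrightarrow> concat (replicate k q) ! j = q ! (j mod length q)"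
proof (induction k arbitrary: j)
  case (Suc k)
  then show ?case
    by (cases "j < length q") (auto simp: nth_append le_mod_geq)
qed simp

text \<open>If all powers of \<open>q\<close> were in \<open>L\<close>, recurrence would place every
  word of \<open>L\<close> inside such a power. A word would then be determined by its length and
  its starting position modulo \<open>length q\<close>, which bounds the complexity.\<close>

lemma no_powers:
  assumes "q \<noteq> []"
  shows "\<exists>k. concat (replicate k q) \<notin> L"
proof (rule ccontr)
  assume "\<not> ?thesis"
  then have pow: "concat (replicate k q) \<in> L" for k by blast
  obtain n where n: "length q < card {w \<in> L. length w = n}"
    using unbounded by blast
  \<comment> \<open>The factor of length \<open>n\<close> that starts at position \<open>i\<close>
    of the periodic word \<open>q q q ...\<close>.\<close>
  define cyc where "cyc i = map (\<lambda>j. q ! ((i + j) mod length q)) [0..<n]" for i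
  have "{w \<in> L. length w = n} \<subseteq> cyc ` {..<length q}"
  proof
    fix u assume u: "u \<in> {w \<in> L. length w = n}"
    then obtain N where N: "\<And>w. w \<in> L \<Longrightarrow> N \<le> length w \<Longrightarrow> sublist u w"
      using recurrent by blast
    have len: "length (concat (replicate k q)) = k * length q" for k
      by (simp add: length_concat sum_list_replicate)
    have "N \<le> N * length q" using assms by (cases q) auto
    then have "sublist u (concat (replicate N q))"
      using N[OF pow] len by simp
    then obtain ps ss where ps: "concat (replicate N q) = ps @ u @ ss"
      unfolding sublist_def by blast
    have "u ! j = cyc (length ps mod length q) ! j" if j: "j < n" for j
    proof -
      have "u ! j = concat (replicate N q) ! (length ps + j)"
        unfolding ps using u j by (simp add: nth_append)
      also have "\<dots> = q ! ((length ps + j) mod length q)"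
      proof (rule nth_concat_replicate)
        have "N * length q = length ps + length u + length ss"
          using arg_cong[OF ps, of length] len by simp
        then show "length ps + j < N * length q" using u j by simp
      qed
      finally show ?thesis using j by (simp add: cyc_def mod_add_left_eq)
    qed
    then have "u = cyc (length ps mod length q)"
      using u by (intro nth_equalityI) (auto simp: cyc_def)
    then show "u \<in> cyc ` {..<length q}" using assms by auto
  qed
  then have "card {w \<in> L. length w = n} \<le> length q"
    using surj_card_le[of "{..<length q}"] by simp
  then show False using n by simp
qed

text \<open>
  Otherwise rewriting the larger of the two words to the smaller one would show that the syntactic
  monoid of \<open>L\<close> is finite, so that some nonempty word could be pumped.
\<close>
lemma separate_less:
  assumes "v \<in> L" and less: "(u, v) \<in> lenlex less_than"
  shows "\<not> same_contexts u v"
proof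
  assume uv: "same_contexts u v"
  obtain N where N: "\<And>w. w \<in> L \<Longrightarrow> N \<le> length w \<Longrightarrow> sublist v w"
    using recurrent[OF \<open>v \<in> L\<close>] by blast
  define S where "S = {w \<in> L. length w \<le> N}"
  \<comment> \<open>A word of length at least \<open>N\<close> contains \<open>v\<close>. Replacing
    \<open>v\<close> by \<open>u\<close> keeps the contexts and descends in the length-lexicographic
    order, so the process ends at a word shorter than \<open>N\<close>.\<close>
  have "\<exists>w'\<in>S. same_contexts w w'" if "w \<in> L" for w
    using wf_lenlex[OF wf_less_than] that
  proof (induction w rule: wf_induct_rule)
    case (less w)
    show ?case
    proof (cases "N \<le> length w")
      case True
      then obtain l r where w: "w = l @ v @ r"
        using N less.prems unfolding sublist_def by blast
      have "(l @ u @ r, w) \<in> lenlex less_than"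
        using \<open>(u, v) \<in> lenlex less_than\<close> unfolding w
        by (auto simp: lenlex_append2 irrefl_def intro!: lenlex_append1)
      moreover have "l @ u @ r \<in> L"
        using uv less.prems w unfolding same_contexts_def by blast
      ultimately obtain w' where "w' \<in> S" "same_contexts (l @ u @ r) w'"
        using less.IH by blast
      moreover have "same_contexts w (l @ u @ r)"
        unfolding w by (rule same_contexts_append) (use uv in \<open>auto simp: same_contexts_def\<close>)
      ultimately show ?thesis using same_contexts_trans by blast
    next
      case False
      then show ?thesis using less.prems by (auto simp: S_def same_contexts_def)
    qed
  qed
  then obtain \<rho> where \<rho>: "\<And>w. w \<in> L \<Longrightarrow> \<rho> w \<in> S \<and> same_contexts w (\<rho> w)" by metis
  obtain w where w: "w \<in> L" "card S \<le> length w" using ex_long by blast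
  have take_L: "take i w \<in> L" for i
    using w(1) factor_closed sublist_take by blast
  \<comment> \<open>Pigeonhole: \<open>w\<close> has more prefixes than \<open>S\<close> has
    elements.\<close>
  have "\<not> inj_on (\<lambda>i. \<rho> (take i w)) {..length w}"
  proof
    assume "inj_on (\<lambda>i. \<rho> (take i w)) {..length w}"
    moreover have "(\<lambda>i. \<rho> (take i w)) ` {..length w} \<subseteq> S" using \<rho> take_L by blast
    moreover have "finite S" unfolding S_def by (rule finite_length_le)
    ultimately have "card {..length w} \<le> card S" by (rule card_inj_on_le)
    then show False using w(2) by simp
  qed
  then obtain i j where ij: "i < j" "j \<le> length w" "\<rho> (take i w) = \<rho> (take j w)"
    unfolding inj_on_def by (metis atMost_iff linorder_neqE_nat)
  define p q where "p = take i w" and "q = drop i (take j w)"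
  have "take j w = p @ q" using ij unfolding p_def q_def
    by (metis append_take_drop_id less_imp_le_nat min.absorb1 take_take)
  \<comment> \<open>Two prefixes with the same representative have the same contexts. Hence
    \<open>q\<close> can be inserted after \<open>p\<close> any number of times without leaving
    \<open>L\<close>.\<close>
  then have pq: "same_contexts p (p @ q)"
    using \<rho>[OF take_L[of i]] \<rho>[OF take_L[of j]] ij(3)
    unfolding p_def same_contexts_def by simp
  have "p @ concat (replicate k q) \<in> L" for k
  proof (induction k)
    case 0
    then show ?case using take_L p_def by simp
  next
    case (Suc k)
    then have "[] @ (p @ q) @ concat (replicate k q) \<in> L"
      using pq unfolding same_contexts_def by (metis append_Nil)
    then show ?case by simp
  qed
  then have "concat (replicate k q) \<in> L" for k
    using factor_closed sublist_append_leftI by blast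
  moreover have "q \<noteq> []" using ij by (simp add: q_def)
  ultimately show False using no_powers by blast
qed

text \<open>Distinct words are comparable in the length-lexicographic order, so
  \<open>separate_less\<close> applies to one of the two orders.\<close>

lemma separate:
  assumes "u \<in> L" "v \<in> L" "u \<noteq> v"
  shows "\<exists>l r. (l @ u @ r \<in> L) \<noteq> (l @ v @ r \<in> L)"
proof -
  have "(u, v) \<in> lenlex less_than \<or> (v, u) \<in> lenlex less_than"
    using total_lenlex[OF total_less_than] \<open>u \<noteq> v\<close> by (auto simp: total_on_def)
  then have "\<not> same_contexts u v \<or> \<not> same_contexts v u" using separate_less assms by blast
  then show ?thesis unfolding same_contexts_def by blast
qed

end

section \<open>A recurrent language of prescribed growth\<close>

text \<open>Level \<open>k\<close> has \<open>2 ^ a k\<close> blocks, and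
  \<open>2 ^ (a (Suc k) - a k)\<close> of them are used as left halves at the next level. By
  \<open>a_double\<close> there are enough blocks for this; by \<open>a_slack\<close> there are
  enough even among those with a prescribed ending of level \<open>i\<close>. By \<open>a_ge\<close>
  the number of blocks is unbounded.\<close>

locale block_exponents =
  fixes a :: "nat \<Rightarrow> nat"
  assumes a_ge: "k \<le> a k"
    and a_mono: "a k \<le> a (Suc k)"
    and a_double: "a (Suc k) \<le> 2 * a k"
    and a_slack: "a i \<le> k \<Longrightarrow> a (Suc k) + a i \<le> 2 * a k"
begin

text \<open>
  Blocks of level \<open>k\<close> are numbered by \<open>{..<2 ^ a k}\<close>, have length \<open>2 ^ k\<close>, and the block number
  \<open>x\<close> of level \<open>k\<close> ends with the block number \<open>x mod 2 ^ a i\<close> of each lower level \<open>i\<close>. Hence the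
  left halves of the blocks of level \<open>k + 1\<close>, whose numbers are the values of \<open>left_half k\<close>, all end
  with the same block \<open>v\<close> of level \<open>i\<close> when \<open>forced k = (a i, v)\<close>.
\<close>
definition forced :: "nat \<Rightarrow> nat \<times> nat" where
  "forced k = (case prod_decode (fst (prod_decode k)) of (i, v) \<Rightarrow>
     if a i \<le> k \<and> v < 2 ^ a i then (a i, v) else (0, 0))"

definition left_half :: "nat \<Rightarrow> nat \<Rightarrow> nat" where
  "left_half k t = t * 2 ^ fst (forced k) + snd (forced k)"

text \<open>The part of \<open>x\<close> above \<open>2 ^ a k\<close> selects the left half, and the
  remainder is the number of the right half. The level 0 blocks are the letters.\<close>

fun block :: "nat \<Rightarrow> nat \<Rightarrow> nat list" where
  "block 0 x = [x]"
| "block (Suc k) x = block k (left_half k (x div 2 ^ a k)) @ block k (x mod 2 ^ a k)"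

definition L :: "nat list set" where
  "L = {u. \<exists>k x. x < 2 ^ a k \<and> sublist u (block k x)}"

section \<open>Numbers, prefixes and suffixes of blocks\<close>

lemma length_block [simp]: "length (block k x) = 2 ^ k"
  by (induction k arbitrary: x) auto

lemma a_mono': "i \<le> k \<Longrightarrow> a i \<le> a k"
  using a_mono by (rule lift_Suc_mono_le)

lemma left_half_less:
  assumes "t < 2 ^ (a (Suc k) - a k)"
  shows "left_half k t < 2 ^ a k"
proof -
  obtain m v where mv: "forced k = (m, v)" by force
  \<comment> \<open>With a prescribed ending, \<open>m\<close> is some \<open>a i\<close> and the
    bound is \<open>a_slack\<close>. In the default case \<open>(0, 0)\<close> the map
    \<open>left_half k\<close> is the identity and the bound is \<open>a_double\<close>.\<close>
  have "v < 2 ^ m \<and> a (Suc k) + m \<le> 2 * a k"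
    using mv a_slack a_double unfolding forced_def by (auto split: prod.splits if_splits)
  then have v: "v < 2 ^ m" and m: "a (Suc k) - a k + m \<le> a k"
    using a_mono[of k] by auto
  have "t * 2 ^ m + v < (t + 1) * 2 ^ m" using v by simp
  also have "\<dots> \<le> 2 ^ (a (Suc k) - a k) * 2 ^ m" using assms by (intro mult_right_mono) auto
  also have "\<dots> \<le> 2 ^ a k" unfolding power_add[symmetric] using m by simp
  finally show ?thesis by (simp add: left_half_def mv)
qed

lemma div_less:
  fixes x :: nat
  assumes "x < 2 ^ a (Suc k)"
  shows "x div 2 ^ a k < 2 ^ (a (Suc k) - a k)"
  using assms a_mono[of k] by (simp add: less_mult_imp_div_less flip: power_add)

lemma left_half_div_less: "x < 2 ^ a (Suc k) \<Longrightarrow> left_half k (x div 2 ^ a k) < 2 ^ a k"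
  using div_less left_half_less by blast

text \<open>Both halves have length \<open>2 ^ k\<close>, so equal blocks have equal halves. By
  induction the halves have equal numbers, and since \<open>left_half k\<close> is injective these
  give back the quotient and the remainder of \<open>x\<close>.\<close>

lemma block_inj: "inj_on (block k) {..<2 ^ a k}"
proof (induction k)
  case (Suc k)
  show ?case
  proof (rule inj_onI)
    fix x y assume x: "x \<in> {..<2 ^ a (Suc k)}" and y: "y \<in> {..<2 ^ a (Suc k)}"
      and "block (Suc k) x = block (Suc k) y"
    then have *: "block k (left_half k (x div 2 ^ a k)) = block k (left_half k (y div 2 ^ a k))"
      "block k (x mod 2 ^ a k) = block k (y mod 2 ^ a k)" by auto
    have "left_half k (x div 2 ^ a k) = left_half k (y div 2 ^ a k)"
      using inj_onD[OF Suc *(1)] left_half_div_less x y by simp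
    then have "x div 2 ^ a k = y div 2 ^ a k" by (simp add: left_half_def)
    moreover have "x mod 2 ^ a k = y mod 2 ^ a k" using inj_onD[OF Suc *(2)] by simp
    ultimately show "x = y" by (metis div_mult_mod_eq)
  qed
qed (simp add: inj_on_def)

text \<open>Passing to the right half reduces the number modulo \<open>2 ^ a k\<close>. This can be
  iterated since \<open>2 ^ a i\<close> divides \<open>2 ^ a k\<close>.\<close>

lemma block_suffix:
  assumes "i \<le> k" "x < 2 ^ a k"
  shows "suffix (block i (x mod 2 ^ a i)) (block k x)"
  using assms
proof (induction arbitrary: x rule: dec_induct)
  case (step k)
  have "suffix (block i (x mod 2 ^ a k mod 2 ^ a i)) (block k (x mod 2 ^ a k))"
    by (rule step.IH) simp
  moreover have "x mod 2 ^ a k mod 2 ^ a i = x mod 2 ^ a i"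
    by (rule mod_mod_cancel) (use a_mono' step.hyps in \<open>simp add: le_imp_power_dvd\<close>)
  ultimately show ?case by (simp add: suffix_appendI)
qed simp

text \<open>Descending through left halves reaches a block of level \<open>Suc i\<close>, so the
  first block of level \<open>i\<close> is itself a left half. This restriction, absent for
  suffixes, keeps the number of junctions small.\<close>

lemma block_prefix_left_half:
  assumes "i < k" "x < 2 ^ a k"
  shows "\<exists>t < 2 ^ (a (Suc i) - a i). prefix (block i (left_half i t)) (block k x)"
proof -
  have "Suc i \<le> k" using assms by simp
  then show ?thesis using assms(2)
  proof (induction arbitrary: x rule: dec_induct)
    case base
    then show ?case using div_less by force
  next
    case (step k)
    obtain t where "t < 2 ^ (a (Suc i) - a i)"
      "prefix (block i (left_half i t)) (block k (left_half k (x div 2 ^ a k)))"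
      using step.IH[OF left_half_div_less[OF step.prems]] by blast
    then show ?case by (auto simp: prefix_append)
  qed
qed

lemma block_prefix:
  assumes "i \<le> k" "x < 2 ^ a k"
  shows "\<exists>y < 2 ^ a i. prefix (block i y) (block k x)"
  using assms block_prefix_left_half[of i k x] left_half_less by (cases "i = k") auto

section \<open>The language of factors of blocks and its recurrence\<close>

lemma in_L_above: "u \<in> L \<Longrightarrow> \<exists>k\<ge>m. \<exists>x<2 ^ a k. sublist u (block k x)"
proof -
  assume "u \<in> L"
  then obtain k x where kx: "x < 2 ^ a k" "sublist u (block k x)" unfolding L_def by blast
  have x: "x < 2 ^ a (max k m)"
    using kx(1) a_mono'[of k "max k m"] by (meson less_le_trans max.cobounded1 one_le_numeral power_increasing)
  \<comment> \<open>The same number \<open>x\<close> belongs to a block of the higher level, and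
    that block ends with \<open>block k x\<close> since \<open>x < 2 ^ a k\<close>.\<close>
  then have "suffix (block k x) (block (max k m) x)"
    using block_suffix[of k "max k m" x] kx(1) by simp
  then have "sublist u (block (max k m) x)" using kx(2) suffix_imp_sublist sublist_order.order_trans by blast
  then show ?thesis using x by (intro exI[of _ "max k m"]) auto
qed

lemma block_in_L: "x < 2 ^ a k \<Longrightarrow> block k x \<in> L"
  unfolding L_def by blast

lemma letters_block: "x < 2 ^ a k \<Longrightarrow> set (block k x) \<subseteq> {..<2 ^ a 0}"
proof (induction k arbitrary: x)
  case (Suc k)
  then show ?case using Suc.IH[OF left_half_div_less[OF Suc.prems]] Suc.IH[of "x mod 2 ^ a k"] by simp
qed simp

lemma factorial: "factorial_language (2 ^ a 0) L"
proof
  show "L \<subseteq> lists {..<2 ^ a 0}"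
    unfolding L_def using letters_block set_mono_sublist by (fastforce simp: in_lists_conv_set)
  show "[] \<in> L" unfolding L_def by (auto intro!: exI[of _ 0])
  show "u \<in> L" if "w \<in> L" "sublist u w" for u w
    using that sublist_order.order_trans unfolding L_def by blast
qed

interpretation factorial_language "2 ^ a 0" L by (rule factorial)

text \<open>At a level that prescribes the ending \<open>(a i, v)\<close>, every left half ends with
  \<open>block i v\<close>, so every block of the next level contains it.\<close>

lemma block_recurs:
  assumes v: "v < 2 ^ a i"
  shows "\<exists>k. \<forall>x<2 ^ a k. sublist (block i v) (block k x)"
proof -
  \<comment> \<open>The code of the pair \<open>(i, v)\<close> is combined with \<open>a i\<close>
    to make \<open>k\<close> at least \<open>a i\<close>, as \<open>forced\<close> requires.\<close>
  define k where "k = prod_encode (prod_encode (i, v), a i)"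
  have k: "a i \<le> k" unfolding k_def by (rule le_prod_encode_2)
  then have "i \<le> k" using a_ge[of i] by simp
  have "forced k = (a i, v)" using v k by (simp add: forced_def k_def)
  then have v: "left_half k t mod 2 ^ a i = v" for t using v by (simp add: left_half_def)
  have "sublist (block i v) (block (Suc k) x)" if "x < 2 ^ a (Suc k)" for x
    using block_suffix[OF \<open>i \<le> k\<close> left_half_div_less[OF that]] v
    by (auto intro!: sublist_appendI suffix_imp_sublist simp: sublist_append)
  then show ?thesis by blast
qed

text \<open>Descend to the block whose midpoint \<open>w\<close> straddles. One of the two parts of
  \<open>w\<close> has length at least \<open>2 ^ k\<close>; it is a suffix of the left half or a
  prefix of the right half and so contains the block of level \<open>k\<close> at that end.\<close>

lemma long_contains_block:
  assumes "sublist w (block m x)" "x < 2 ^ a m" "2 * 2 ^ k \<le> length w"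
  shows "\<exists>y<2 ^ a k. sublist (block k y) w"
  using assms
proof (induction m arbitrary: x)
  case 0
  then have "length w \<le> 1" using sublist_length_le by fastforce
  moreover have "(1::nat) \<le> 2 ^ k" by simp
  ultimately show ?case using 0 by linarith
next
  case (Suc m)
  have "length w \<le> 2 ^ Suc m" using sublist_length_le[OF Suc.prems(1)] by simp
  then have "(2::nat) ^ Suc k \<le> 2 ^ Suc m" unfolding power_Suc using Suc.prems(3) by linarith
  then have "Suc k \<le> Suc m" by (subst (asm) power_increasing_iff) simp_all
  then have "k \<le> m" by simp
  let ?y = "left_half m (x div 2 ^ a m)" and ?z = "x mod 2 ^ a m"
  have y: "?y < 2 ^ a m" using left_half_div_less Suc.prems(2) by blast
  have z: "?z < 2 ^ a m" by simp
  consider "sublist w (block m ?y)" | "sublist w (block m ?z)"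
    | s p where "w = s @ p" "suffix s (block m ?y)" "prefix p (block m ?z)"
    using Suc.prems(1) by (auto simp: sublist_append)
  then show ?case
  proof cases
    case 1
    then show ?thesis using Suc.IH y Suc.prems(3) by blast
  next
    case 2
    then show ?thesis using Suc.IH z Suc.prems(3) by blast
  next
    case 3
    then have "2 ^ k \<le> length s \<or> 2 ^ k \<le> length p" using Suc.prems(3) by auto
    then show ?thesis
    proof
      assume "2 ^ k \<le> length s"
      then have "suffix (block k (?y mod 2 ^ a k)) s"
        using suffix_length_suffix[OF block_suffix[OF \<open>k \<le> m\<close> y] 3(2)] by simp
      then show ?thesis unfolding 3(1)
        by (intro exI[of _ "?y mod 2 ^ a k"]) (auto simp: sublist_append suffix_imp_sublist)
    next
      assume *: "2 ^ k \<le> length p"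
      obtain y' where y': "y' < 2 ^ a k" "prefix (block k y') (block m ?z)"
        using block_prefix[OF \<open>k \<le> m\<close> z] by blast
      then have "prefix (block k y') p" using prefix_length_prefix[OF y'(2) 3(3)] * by simp
      then show ?thesis unfolding 3(1) using y'(1)
        by (auto simp: sublist_append prefix_imp_sublist)
    qed
  qed
qed

lemma card_length_ge: "2 ^ a k \<le> card {w \<in> L. length w = 2 ^ k}"
proof -
  have "card (block k ` {..<2 ^ a k}) \<le> card {w \<in> L. length w = 2 ^ k}"
    by (intro card_mono finite_length) (auto simp: block_in_L)
  then show ?thesis by (simp add: card_image block_inj)
qed

text \<open>A word lies in some block, that block lies in all blocks of some level \<open>k\<close>,
  and every word of length at least \<open>2 * 2 ^ k\<close> contains a block of level
  \<open>k\<close>.\<close>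

lemma recurrent_L: "recurrent_language (2 ^ a 0) L"
proof
  show "\<exists>N. \<forall>w\<in>L. N \<le> length w \<longrightarrow> sublist u w" if u: "u \<in> L" for u
  proof -
    obtain i v where v: "v < 2 ^ a i" "sublist u (block i v)" using u unfolding L_def by blast
    obtain k where k: "\<And>x. x < 2 ^ a k \<Longrightarrow> sublist (block i v) (block k x)"
      using block_recurs[OF v(1)] by blast
    have "sublist u w" if w: "w \<in> L" "2 * 2 ^ k \<le> length w" for w
    proof -
      obtain y where "y < 2 ^ a k" "sublist (block k y) w"
        using w long_contains_block unfolding L_def by blast
      then show ?thesis using k v(2) sublist_order.order_trans by blast
    qed
    then show ?thesis by blast
  qed
  show "\<exists>n. B < card {w \<in> L. length w = n}" for B
  proof -
    have "B < 2 ^ a B" using a_ge[of B] by (metis less_exp less_le_trans one_le_numeral power_increasing)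
    then show ?thesis using card_length_ge[of B] by (intro exI[of _ "2 ^ B"]) linarith
  qed
qed

section \<open>Upper bound for the number of words\<close>

text \<open>A set that includes all pairs of neighbouring blocks of level \<open>k\<close>. The
  first part consists of the blocks of level \<open>Suc k\<close>; the second covers the seams
  between two of those, where a left half follows.\<close>

definition junctions :: "nat \<Rightarrow> nat list set" where
  "junctions k = (\<lambda>(t, y). block k (left_half k t) @ block k y) ` ({..<2 ^ (a (Suc k) - a k)} \<times> {..<2 ^ a k})
     \<union> (\<lambda>(t, y). block k y @ block k (left_half k t)) ` ({..<2 ^ (a (Suc k) - a k)} \<times> {..<2 ^ a k})"

text \<open>Each of the two parts has at most
  \<open>2 ^ (a (Suc k) - a k) * 2 ^ a k = 2 ^ a (Suc k)\<close> elements.\<close>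

lemma card_junctions: "card (junctions k) \<le> 2 * 2 ^ a (Suc k)"
proof -
  have *: "card (g ` ({..<2 ^ (a (Suc k) - a k)} \<times> {..<2 ^ a k})) \<le> 2 ^ a (Suc k)"
    for g :: "nat \<times> nat \<Rightarrow> nat list"
    using card_image_le[of "{..<2 ^ (a (Suc k) - a k)} \<times> {..<2 ^ a k}" g] a_mono[of k]
    by (simp flip: power_add)
  show ?thesis unfolding junctions_def mult_2
    by (rule order.trans[OF card_Un_le add_mono[OF * *]])
qed

text \<open>Descend to the midpoint that \<open>u\<close> straddles, or to level
  \<open>Suc k\<close>. Being short, \<open>u\<close> meets only the last block of level
  \<open>k\<close> before the midpoint and the first one after it, and the latter is a left half by
  \<open>block_prefix_left_half\<close>.\<close>

lemma sublist_junction: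
  assumes "Suc k \<le> m" "x < 2 ^ a m" "sublist u (block m x)" "length u \<le> 2 ^ k"
  shows "\<exists>w\<in>junctions k. sublist u w"
  using assms
proof (induction arbitrary: x rule: dec_induct)
  case base
  have "block (Suc k) x \<in> junctions k"
    unfolding junctions_def using div_less[OF base(1)]
    by (intro UnI1 image_eqI[of _ _ "(x div 2 ^ a k, x mod 2 ^ a k)"]) auto
  then show ?case using base by blast
next
  case (step m)
  let ?y = "left_half m (x div 2 ^ a m)" and ?z = "x mod 2 ^ a m"
  have y: "?y < 2 ^ a m" using left_half_div_less step.prems(1) by blast
  have z: "?z < 2 ^ a m" by simp
  consider "sublist u (block m ?y)" | "sublist u (block m ?z)"
    | s p where "u = s @ p" "suffix s (block m ?y)" "prefix p (block m ?z)"
    using step.prems(2) by (auto simp: sublist_append)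
  then show ?case
  proof cases
    case 1
    then show ?thesis using step.IH y step.prems(3) by blast
  next
    case 2
    then show ?thesis using step.IH z step.prems(3) by blast
  next
    case 3
    have "k \<le> m" "k < m" using step.hyps by auto
    have "suffix s (block k (?y mod 2 ^ a k))"
      using suffix_length_suffix[OF 3(2) block_suffix[OF \<open>k \<le> m\<close> y]] 3(1) step.prems(3) by simp
    moreover obtain t where t: "t < 2 ^ (a (Suc k) - a k)"
      "prefix (block k (left_half k t)) (block m ?z)"
      using block_prefix_left_half[OF \<open>k < m\<close> z] by blast
    then have "prefix p (block k (left_half k t))"
      using prefix_length_prefix[OF 3(3) t(2)] 3(1) step.prems(3) by simp
    ultimately have "sublist u (block k (?y mod 2 ^ a k) @ block k (left_half k t))"
      unfolding 3(1) sublist_append by blast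
    moreover have "block k (?y mod 2 ^ a k) @ block k (left_half k t) \<in> junctions k"
      unfolding junctions_def using t(1)
      by (intro UnI2 image_eqI[of _ _ "(t, ?y mod 2 ^ a k)"]) auto
    ultimately show ?thesis by blast
  qed
qed

text \<open>A word of length at most \<open>2 ^ k\<close> is determined by a junction, a starting
  position and a length. A junction has length \<open>2 * 2 ^ k\<close>, which leaves
  \<open>2 * 2 ^ k + 1\<close> values for each of the two numbers.\<close>

lemma card_length_le: "card {w \<in> L. length w \<le> 2 ^ k} \<le> 2 * 2 ^ a (Suc k) * (2 * 2 ^ k + 1) ^ 2"
proof -
  let ?T = "junctions k \<times> {..2 * 2 ^ k :: nat} \<times> {..2 * 2 ^ k :: nat}"
  let ?g = "\<lambda>(w, i, j). take j (drop i w) :: nat list"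
  have fin: "finite ?T" unfolding junctions_def by auto
  have "{w \<in> L. length w \<le> 2 ^ k} \<subseteq> ?g ` ?T"
  proof
    fix u assume u: "u \<in> {w \<in> L. length w \<le> 2 ^ k}"
    then obtain m x where "Suc k \<le> m" "x < 2 ^ a m" "sublist u (block m x)"
      using in_L_above by blast
    then obtain w where w: "w \<in> junctions k" "sublist u w"
      using sublist_junction u by blast
    then obtain ps ss where ps: "w = ps @ u @ ss" unfolding sublist_def by blast
    have "length w = 2 * 2 ^ k" using w(1) unfolding junctions_def by auto
    then have "(w, length ps, length u) \<in> ?T" using w ps by auto
    moreover have "?g (w, length ps, length u) = u" using ps by simp
    ultimately show "u \<in> ?g ` ?T" by (metis imageI)
  qed
  then have "card {w \<in> L. length w \<le> 2 ^ k} \<le> card (?g ` ?T)"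
    using fin by (intro card_mono finite_imageI)
  also have "\<dots> \<le> card ?T" using fin by (rule card_image_le)
  also have "\<dots> = card (junctions k) * (2 * 2 ^ k + 1) ^ 2"
    by (simp add: card_cartesian_product power2_eq_square)
  also have "\<dots> \<le> 2 * 2 ^ a (Suc k) * (2 * 2 ^ k + 1) ^ 2"
    using card_junctions by (rule mult_right_mono) simp
  finally show ?thesis .
qed

end

section \<open>Choice of the exponents from \<open>f\<close>\<close>

lemma mono_from_one:
  fixes f :: "nat \<Rightarrow> nat"
  assumes "\<forall>n\<ge>1. f n \<le> f (n + 1)" "1 \<le> m" "m \<le> n"
  shows "f m \<le> f n"
  using assms(3)
proof (induction rule: dec_induct)
  case (step n)
  then show ?case using assms(1,2) by (metis Suc_eq_plus1 le_trans)
qed simp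

text \<open>Induction on \<open>j\<close>: another factor \<open>n\<close> is at most
  \<open>C ^ j * n\<close>, the argument already reached, and one more use of the hypothesis absorbs
  it.\<close>

lemma absorb_power:
  fixes f :: "nat \<Rightarrow> nat"
  assumes "C \<ge> 1" and f: "\<And>n. n \<ge> 1 \<Longrightarrow> n * f n \<le> f (C * n)" and "n \<ge> 1"
  shows "n ^ j * f n \<le> f (C ^ j * n)"
proof (induction j)
  case (Suc j)
  have "n \<le> C ^ j * n" using \<open>C \<ge> 1\<close> by simp
  then have "n * (n ^ j * f n) \<le> (C ^ j * n) * f (C ^ j * n)"
    using Suc.IH by (rule mult_mono) simp_all
  also have "\<dots> \<le> f (C * (C ^ j * n))" using assms by (intro f) simp
  finally show ?case by (simp add: mult.assoc)
qed simp

lemma ex_power_two_between: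
  assumes "n \<ge> (1::nat)"
  shows "\<exists>k. n \<le> 2 ^ k \<and> 2 ^ k \<le> 2 * n"
proof -
  define k where "k = (LEAST k. n \<le> 2 ^ k)"
  have "n \<le> 2 ^ k" unfolding k_def by (rule LeastI[of _ n]) (simp add: less_imp_le)
  moreover have "2 ^ k \<le> 2 * n"
  proof (cases k)
    case (Suc j)
    then have "\<not> n \<le> 2 ^ j" using not_less_Least[of j "\<lambda>k. n \<le> 2 ^ k"] k_def by simp
    then show ?thesis using Suc by simp
  qed (use assms in simp)
  ultimately show ?thesis by blast
qed

definition log_ceiling :: "(nat \<Rightarrow> nat) \<Rightarrow> nat \<Rightarrow> nat" where
  "log_ceiling f k = (LEAST b. f (2 ^ k) \<le> 2 ^ b)"

lemma le_power_log_ceiling: "f (2 ^ k) \<le> 2 ^ log_ceiling f k"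
  unfolding log_ceiling_def by (rule LeastI[of _ "f (2 ^ k)"]) (simp add: less_imp_le)

lemma power_log_ceiling_le:
  assumes "f (2 ^ k) \<ge> 1"
  shows "2 ^ log_ceiling f k \<le> 2 * f (2 ^ k)"
proof (cases "log_ceiling f k")
  case (Suc b)
  then have "\<not> f (2 ^ k) \<le> 2 ^ b"
    using not_less_Least[of b "\<lambda>b. f (2 ^ k) \<le> 2 ^ b"] log_ceiling_def[of f k] by simp
  then show ?thesis using Suc by simp
qed (use assms in simp)

text \<open>Submultiplicativity gives \<open>f (2 ^ Suc k) \<le> f (2 ^ k) * f (2 ^ k)\<close>,
  hence \<open>a_double\<close>. The summand \<open>k + 1\<close> grows by one while its double
  exceeds it by \<open>k + 1\<close>; the difference \<open>k\<close> is the room that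
  \<open>a_slack\<close> needs.\<close>

lemma block_exponents_log_ceiling:
  assumes mono: "\<forall>n\<ge>1. f n \<le> f (n + 1)"
    and submult: "\<forall>m\<ge>1. \<forall>n\<ge>1. f (m + n) \<le> f m * f n"
  shows "block_exponents (\<lambda>k. log_ceiling f k + k + 1)"
proof -
  have mono': "log_ceiling f k \<le> log_ceiling f (Suc k)" for k
  proof -
    have "f (2 ^ k) \<le> f (2 ^ Suc k)" by (rule mono_from_one[OF mono]) auto
    also have "\<dots> \<le> 2 ^ log_ceiling f (Suc k)" by (rule le_power_log_ceiling)
    finally show ?thesis unfolding log_ceiling_def[of f k] by (rule Least_le)
  qed
  have double: "log_ceiling f (Suc k) \<le> 2 * log_ceiling f k" for k
  proof -
    have "f (2 ^ Suc k) \<le> f (2 ^ k) * f (2 ^ k)"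
      using submult[rule_format, of "2 ^ k" "2 ^ k"] by (simp add: mult_2)
    also have "\<dots> \<le> 2 ^ log_ceiling f k * 2 ^ log_ceiling f k"
      by (intro mult_mono le_power_log_ceiling) simp_all
    also have "\<dots> = 2 ^ (2 * log_ceiling f k)" by (simp add: mult_2 power_add)
    finally show ?thesis unfolding log_ceiling_def[of f "Suc k"] by (rule Least_le)
  qed
  show ?thesis
  proof
    show "log_ceiling f (Suc k) + Suc k + 1 + (log_ceiling f i + i + 1) \<le> 2 * (log_ceiling f k + k + 1)"
      if "log_ceiling f i + i + 1 \<le> k" for i k
      using double[of k] that by simp
  qed (use mono' double in \<open>auto intro: le_SucI trans_le_add2\<close>)
qed

text \<open>The number of blocks of level \<open>k\<close> lies between \<open>f (2 ^ k)\<close> and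
  \<open>4 * 2 ^ k * f (2 ^ k)\<close>. Counting all words instead of blocks costs another
  polynomial factor, and \<open>absorb\<close> turns these factors into a rescaling of the
  argument.\<close>

theorem ex_recurrent_language:
  fixes f :: "nat \<Rightarrow> nat"
  assumes pos: "\<forall>n\<ge>1. f n \<ge> 1"
    and mono: "\<forall>n\<ge>1. f n \<le> f (n + 1)"
    and submult: "\<forall>m\<ge>1. \<forall>n\<ge>1. f (m + n) \<le> f m * f n"
    and "C \<ge> 1" and absorb: "\<forall>n\<ge>1. f (C * n) \<ge> n * f n"
  shows "\<exists>d L c. recurrent_language d L \<and> c \<ge> 1 \<and>
    (\<forall>n\<ge>1. card {w \<in> L. length w \<le> n} \<le> f (c * n) \<and> f n \<le> card {w \<in> L. length w \<le> 2 * n})"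
proof -
  let ?a = "\<lambda>k. log_ceiling f k + k + 1"
  interpret block_exponents ?a by (rule block_exponents_log_ceiling[OF mono submult])
  interpret recurrent_language "2 ^ ?a 0" L by (rule recurrent_L)
  \<comment> \<open>The count is at most \<open>2 ^ 5 * N ^ 3 * f N\<close> for a power of two
    \<open>N\<close> with \<open>2 \<le> N \<le> 4 * n\<close>. Hence it is at most
    \<open>N ^ 8 * f N\<close>, and eight applications of \<open>absorb\<close> give the factor
    \<open>C ^ 8\<close>.\<close>
  have "card {w \<in> L. length w \<le> n} \<le> f (C ^ 8 * 4 * n)" if n: "n \<ge> 1" for n
  proof -
    obtain k where k: "n \<le> 2 ^ k" "2 ^ k \<le> 2 * n" using ex_power_two_between[OF n] by blast
    define N :: nat where "N = 2 ^ Suc k"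
    have N: "2 \<le> N" "N \<le> 4 * n" using k(2) by (auto simp: N_def)
    have "card {w \<in> L. length w \<le> n} \<le> card {w \<in> L. length w \<le> 2 ^ k}"
      using k(1) by (intro card_mono finite_length_le) auto
    also have "\<dots> \<le> 2 * 2 ^ ?a (Suc k) * (2 * 2 ^ k + 1) ^ 2" by (rule card_length_le)
    also have "\<dots> = (4 * N * (N + 1) ^ 2) * 2 ^ log_ceiling f (Suc k)"
      by (simp add: N_def power_add)
    also have "\<dots> \<le> (4 * N * (2 * N) ^ 2) * (2 * f N)"
      unfolding N_def using N(1) pos
      by (intro mult_mono power_mono power_log_ceiling_le) (simp_all add: N_def)
    also have "\<dots> = (2 ^ 5 * N ^ 3) * f N"
      by (simp add: power2_eq_square power3_eq_cube)
    also have "\<dots> \<le> (N ^ 5 * N ^ 3) * f N"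
      using N(1) by (intro mult_right_mono power_mono) auto
    also have "\<dots> = N ^ 8 * f N" by (simp flip: power_add)
    also have "\<dots> \<le> f (C ^ 8 * N)"
      using N(1) absorb \<open>C \<ge> 1\<close> by (intro absorb_power) auto
    also have "\<dots> \<le> f (C ^ 8 * 4 * n)"
      using N \<open>C \<ge> 1\<close> by (intro mono_from_one[OF mono]) auto
    finally show ?thesis .
  qed
  moreover have "f n \<le> card {w \<in> L. length w \<le> 2 * n}" if n: "n \<ge> 1" for n
  proof -
    obtain k where k: "n \<le> 2 ^ k" "2 ^ k \<le> 2 * n" using ex_power_two_between[OF n] by blast
    have "f n \<le> f (2 ^ k)" using n k by (intro mono_from_one[OF mono])
    also have "\<dots> \<le> 2 ^ log_ceiling f k" by (rule le_power_log_ceiling)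
    also have "\<dots> \<le> 2 ^ ?a k" by (rule power_increasing) auto
    also have "\<dots> \<le> card {w \<in> L. length w = 2 ^ k}" by (rule card_length_ge)
    also have "\<dots> \<le> card {w \<in> L. length w \<le> 2 * n}"
      using k by (intro card_mono finite_length_le) auto
    finally show ?thesis .
  qed
  moreover have "C ^ 8 * 4 \<ge> 1" using \<open>C \<ge> 1\<close> by simp
  ultimately show ?thesis using recurrent_language_axioms by blast
qed

section \<open>Monomial algebras\<close>

text \<open>Interchange of summation over the triangle \<open>j \<le> i \<le> n\<close> with
  \<open>i = j + k\<close>, as needed for associativity. The induction splits off the terms with
  \<open>i = Suc n\<close>.\<close>

lemma (in abelian_monoid) finsum_triangle:
  fixes n :: nat
  assumes "\<And>j i. h j i \<in> carrier G"
  shows "(\<Oplus>i\<in>{..n}. \<Oplus>j\<in>{..i}. h j i) = (\<Oplus>j\<in>{..n}. \<Oplus>k\<in>{..n - j}. h j (j + k))"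
proof (induction n)
  case 0
  then show ?case using assms by simp
next
  case (Suc n)
  have "(\<Oplus>j\<in>{..Suc n}. \<Oplus>k\<in>{..Suc n - j}. h j (j + k))
      = h (Suc n) (Suc n) \<oplus> (\<Oplus>j\<in>{..n}. \<Oplus>k\<in>{..Suc n - j}. h j (j + k))"
    using assms by (simp add: finsum_Suc)
  also have "(\<Oplus>j\<in>{..n}. \<Oplus>k\<in>{..Suc n - j}. h j (j + k))
      = (\<Oplus>j\<in>{..n}. h j (Suc n) \<oplus> (\<Oplus>k\<in>{..n - j}. h j (j + k)))"
    using assms by (intro finsum_cong') (auto simp: Suc_diff_le finsum_Suc)
  also have "\<dots> = (\<Oplus>j\<in>{..n}. h j (Suc n)) \<oplus> (\<Oplus>j\<in>{..n}. \<Oplus>k\<in>{..n - j}. h j (j + k))"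
    using assms by (intro finsum_addf) auto
  also have "h (Suc n) (Suc n) \<oplus> \<dots>
      = (\<Oplus>j\<in>{..Suc n}. h j (Suc n)) \<oplus> (\<Oplus>j\<in>{..n}. \<Oplus>k\<in>{..n - j}. h j (j + k))"
    using assms by (simp add: finsum_Suc a_assoc)
  also have "\<dots> = (\<Oplus>i\<in>{..Suc n}. \<Oplus>j\<in>{..i}. h j i)"
    using assms Suc by (simp add: finsum_Suc[of "\<lambda>i. finsum G (\<lambda>j. h j i) {..i}"])
  finally show ?case by simp
qed

lemma (in abelian_monoid) finsum_single:
  assumes "finite S" "i \<in> S" "f i \<in> carrier G" "\<And>j. j \<in> S \<Longrightarrow> j \<noteq> i \<Longrightarrow> f j = \<zero>"
  shows "finsum G f S = f i"
proof -
  have "finsum G f S = (\<Oplus>j\<in>S. if i = j then f j else \<zero>)"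
    using assms by (intro finsum_cong') auto
  also have "\<dots> = f i"
    using assms by (intro add.finprod_singleton) (auto, metis zero_closed)
  finally show ?thesis .
qed

text \<open>\<open>word_monomial\<close> with a coefficient, so that the scalars are the monomials
  at \<open>[]\<close>.\<close>

definition monomial :: "('a, 'b) ring_scheme \<Rightarrow> 'a \<Rightarrow> nat list \<Rightarrow> nat list \<Rightarrow> 'a" where
  "monomial F c u = (\<lambda>w. if w = u then c else \<zero>\<^bsub>F\<^esub>)"

section \<open>Ring structure of the free algebra\<close>

locale free_algebra_field = F?: field F for F :: "('a, 'b) ring_scheme" (structure) +
  fixes d :: nat
begin

abbreviation "A \<equiv> free_algebra F d"

abbreviation supp :: "(nat list \<Rightarrow> 'a) \<Rightarrow> nat list set" where
  "supp p \<equiv> {w. p w \<noteq> \<zero>}"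

lemma free_carrier_iff: "p \<in> carrier A \<longleftrightarrow>
    (\<forall>w. p w \<in> carrier F) \<and> finite (supp p) \<and> supp p \<subseteq> lists {..<d}"
  by (auto simp: free_algebra_def)

lemma coeff_closed [simp]: "p \<in> carrier A \<Longrightarrow> p w \<in> carrier F"
  by (simp add: free_carrier_iff)

lemma coeff_mult: "(p \<otimes>\<^bsub>A\<^esub> q) w = (\<Oplus>i\<in>{..length w}. p (take i w) \<otimes> q (drop i w))"
  by (simp add: free_algebra_def)

lemma coeff_add [simp]: "(p \<oplus>\<^bsub>A\<^esub> q) w = p w \<oplus> q w"
  by (simp add: free_algebra_def)

lemma coeff_zero [simp]: "\<zero>\<^bsub>A\<^esub> w = \<zero>"
  by (simp add: free_algebra_def)

lemma free_one: "\<one>\<^bsub>A\<^esub> = monomial F \<one> []"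
  by (auto simp: free_algebra_def monomial_def)

lemma monomial_closed: "c \<in> carrier F \<Longrightarrow> u \<in> lists {..<d} \<Longrightarrow> monomial F c u \<in> carrier A"
  unfolding free_carrier_iff by (auto simp: monomial_def intro: finite_subset[of _ "{u}"])

lemma coeff_mult_nonzero:
  assumes "p \<in> carrier A" "q \<in> carrier A" "(p \<otimes>\<^bsub>A\<^esub> q) w \<noteq> \<zero>"
  shows "\<exists>u v. w = u @ v \<and> p u \<noteq> \<zero> \<and> q v \<noteq> \<zero>"
proof (rule ccontr)
  assume *: "\<not> ?thesis"
  have "p (take i w) \<otimes> q (drop i w) = \<zero>" for i
  proof -
    have "p (take i w) = \<zero> \<or> q (drop i w) = \<zero>"
      using * by (metis append_take_drop_id)
    then show ?thesis using assms by auto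
  qed
  then have "(p \<otimes>\<^bsub>A\<^esub> q) w = \<zero>" unfolding coeff_mult by simp
  then show False using assms(3) by simp
qed

lemma free_mult_closed:
  assumes "p \<in> carrier A" "q \<in> carrier A"
  shows "p \<otimes>\<^bsub>A\<^esub> q \<in> carrier A"
proof -
  have sub: "supp (p \<otimes>\<^bsub>A\<^esub> q) \<subseteq> (\<lambda>(u, v). u @ v) ` (supp p \<times> supp q)"
    using coeff_mult_nonzero[OF assms] by fastforce
  have "finite (supp (p \<otimes>\<^bsub>A\<^esub> q))"
    using assms by (intro finite_subset[OF sub]) (auto simp: free_carrier_iff)
  moreover have "supp (p \<otimes>\<^bsub>A\<^esub> q) \<subseteq> lists {..<d}"
    using sub assms unfolding free_carrier_iff by fastforce
  moreover have "(p \<otimes>\<^bsub>A\<^esub> q) w \<in> carrier F" for w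
    unfolding coeff_mult using assms by (intro finsum_closed) auto
  ultimately show ?thesis unfolding free_carrier_iff by blast
qed

text \<open>Both sides sum over the factorisations of \<open>w\<close> into three words, with cuts
  at \<open>j \<le> i\<close>. They differ in the order of summation only.\<close>

lemma free_mult_assoc:
  assumes "p \<in> carrier A" "q \<in> carrier A" "r \<in> carrier A"
  shows "(p \<otimes>\<^bsub>A\<^esub> q) \<otimes>\<^bsub>A\<^esub> r = p \<otimes>\<^bsub>A\<^esub> (q \<otimes>\<^bsub>A\<^esub> r)"
proof
  fix w
  let ?h = "\<lambda>j i. p (take j w) \<otimes> q (drop j (take i w)) \<otimes> r (drop i w)"
  have h: "?h j i \<in> carrier F" for j i using assms by simp
  have "((p \<otimes>\<^bsub>A\<^esub> q) \<otimes>\<^bsub>A\<^esub> r) w = (\<Oplus>i\<in>{..length w}. \<Oplus>j\<in>{..i}. ?h j i)"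
    unfolding coeff_mult[of "p \<otimes>\<^bsub>A\<^esub> q"]
  proof (intro finsum_cong' refl)
    fix i assume i: "i \<in> {..length w}"
    have "(p \<otimes>\<^bsub>A\<^esub> q) (take i w) = (\<Oplus>j\<in>{..i}. p (take j w) \<otimes> q (drop j (take i w)))"
      unfolding coeff_mult using i assms by (intro finsum_cong') (auto simp: min_def)
    then show "(p \<otimes>\<^bsub>A\<^esub> q) (take i w) \<otimes> r (drop i w) = (\<Oplus>j\<in>{..i}. ?h j i)"
      using assms by (simp add: finsum_ldistr)
  qed (use h in \<open>auto intro: finsum_closed\<close>)
  also have "\<dots> = (\<Oplus>j\<in>{..length w}. \<Oplus>k\<in>{..length w - j}. ?h j (j + k))"
    using h by (rule finsum_triangle)
  also have "\<dots> = (p \<otimes>\<^bsub>A\<^esub> (q \<otimes>\<^bsub>A\<^esub> r)) w"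
    unfolding coeff_mult[of p]
  proof (intro finsum_cong' refl)
    fix j assume j: "j \<in> {..length w}"
    have "(q \<otimes>\<^bsub>A\<^esub> r) (drop j w) = (\<Oplus>k\<in>{..length w - j}. q (drop j (take (j + k) w)) \<otimes> r (drop (j + k) w))"
      unfolding coeff_mult using j assms
      by (intro finsum_cong') (auto simp: drop_take add.commute)
    then show "(\<Oplus>k\<in>{..length w - j}. ?h j (j + k)) = p (take j w) \<otimes> (q \<otimes>\<^bsub>A\<^esub> r) (drop j w)"
      using assms by (simp add: finsum_rdistr m_assoc)
  qed (use assms free_mult_closed in auto)
  finally show "((p \<otimes>\<^bsub>A\<^esub> q) \<otimes>\<^bsub>A\<^esub> r) w = (p \<otimes>\<^bsub>A\<^esub> (q \<otimes>\<^bsub>A\<^esub> r)) w" .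
qed

lemma coeff_mult_monomial_right:
  assumes "p \<in> carrier A" "c \<in> carrier F"
  shows "(p \<otimes>\<^bsub>A\<^esub> monomial F c u) (w @ u) = p w \<otimes> c"
proof -
  have "(p \<otimes>\<^bsub>A\<^esub> monomial F c u) (w @ u)
      = p (take (length w) (w @ u)) \<otimes> monomial F c u (drop (length w) (w @ u))"
    unfolding coeff_mult
  proof (rule finsum_single)
    fix j assume "j \<in> {..length (w @ u)}" "j \<noteq> length w"
    then have "drop j (w @ u) \<noteq> u"
      by (metis atMost_iff add_diff_cancel_right' diff_diff_cancel length_append length_drop)
    then show "p (take j (w @ u)) \<otimes> monomial F c u (drop j (w @ u)) = \<zero>"
      using assms by (simp add: monomial_def)
  qed (use assms in \<open>auto simp: monomial_def\<close>)
  then show ?thesis by (simp add: monomial_def)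
qed

lemma coeff_mult_monomial_left:
  assumes "p \<in> carrier A" "c \<in> carrier F"
  shows "(monomial F c u \<otimes>\<^bsub>A\<^esub> p) (u @ w) = c \<otimes> p w"
proof -
  have "(monomial F c u \<otimes>\<^bsub>A\<^esub> p) (u @ w)
      = monomial F c u (take (length u) (u @ w)) \<otimes> p (drop (length u) (u @ w))"
    unfolding coeff_mult
  proof (rule finsum_single)
    fix j assume "j \<in> {..length (u @ w)}" "j \<noteq> length u"
    then have "take j (u @ w) \<noteq> u"
      by (metis atMost_iff length_take min.absorb2)
    then show "monomial F c u (take j (u @ w)) \<otimes> p (drop j (u @ w)) = \<zero>"
      using assms by (simp add: monomial_def)
  qed (use assms in \<open>auto simp: monomial_def\<close>)
  then show ?thesis by (simp add: monomial_def)
qed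

lemma free_algebra_ring: "ring A"
proof (rule ringI)
  show "abelian_group A"
  proof (rule abelian_groupI)
    show "x \<oplus>\<^bsub>A\<^esub> y \<in> carrier A" if "x \<in> carrier A" "y \<in> carrier A" for x y
    proof -
      have "supp (x \<oplus>\<^bsub>A\<^esub> y) \<subseteq> supp x \<union> supp y" by auto
      moreover have "finite (supp x \<union> supp y)" "supp x \<union> supp y \<subseteq> lists {..<d}"
        using that by (simp_all add: free_carrier_iff)
      ultimately have "finite (supp (x \<oplus>\<^bsub>A\<^esub> y))" "supp (x \<oplus>\<^bsub>A\<^esub> y) \<subseteq> lists {..<d}"
        by - (meson finite_subset, meson order_trans)
      then show ?thesis using that unfolding free_carrier_iff by simp
    qed
    show "\<exists>y\<in>carrier A. y \<oplus>\<^bsub>A\<^esub> x = \<zero>\<^bsub>A\<^esub>" if "x \<in> carrier A" for x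
    proof
      show "(\<lambda>w. \<ominus> x w) \<in> carrier A"
        using that by (auto simp: free_carrier_iff elim: rev_finite_subset)
      show "(\<lambda>w. \<ominus> x w) \<oplus>\<^bsub>A\<^esub> x = \<zero>\<^bsub>A\<^esub>"
        using that by (auto simp: l_neg)
    qed
  qed (auto simp: free_carrier_iff a_ac)
  show "Group.monoid A"
  proof (rule monoidI)
    show "\<one>\<^bsub>A\<^esub> \<in> carrier A" unfolding free_one by (rule monomial_closed) auto
    show "\<one>\<^bsub>A\<^esub> \<otimes>\<^bsub>A\<^esub> x = x" if "x \<in> carrier A" for x
      using coeff_mult_monomial_left[OF that one_closed, of "[]"] that by (auto simp: free_one)
    show "x \<otimes>\<^bsub>A\<^esub> \<one>\<^bsub>A\<^esub> = x" if "x \<in> carrier A" for x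
      using coeff_mult_monomial_right[OF that one_closed, of "[]"] that by (auto simp: free_one)
  qed (auto simp: free_mult_closed free_mult_assoc)
  show "(x \<oplus>\<^bsub>A\<^esub> y) \<otimes>\<^bsub>A\<^esub> z = x \<otimes>\<^bsub>A\<^esub> z \<oplus>\<^bsub>A\<^esub> y \<otimes>\<^bsub>A\<^esub> z"
    if "x \<in> carrier A" "y \<in> carrier A" "z \<in> carrier A" for x y z
  proof
    fix w
    have "((x \<oplus>\<^bsub>A\<^esub> y) \<otimes>\<^bsub>A\<^esub> z) w = (\<Oplus>i\<in>{..length w}. x (take i w) \<otimes> z (drop i w) \<oplus> y (take i w) \<otimes> z (drop i w))"
      unfolding coeff_mult using that by (intro finsum_cong') (auto simp: l_distr)
    also have "\<dots> = (x \<otimes>\<^bsub>A\<^esub> z \<oplus>\<^bsub>A\<^esub> y \<otimes>\<^bsub>A\<^esub> z) w"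
      unfolding coeff_add coeff_mult using that by (intro finsum_addf) auto
    finally show "((x \<oplus>\<^bsub>A\<^esub> y) \<otimes>\<^bsub>A\<^esub> z) w = (x \<otimes>\<^bsub>A\<^esub> z \<oplus>\<^bsub>A\<^esub> y \<otimes>\<^bsub>A\<^esub> z) w" .
  qed
  show "z \<otimes>\<^bsub>A\<^esub> (x \<oplus>\<^bsub>A\<^esub> y) = z \<otimes>\<^bsub>A\<^esub> x \<oplus>\<^bsub>A\<^esub> z \<otimes>\<^bsub>A\<^esub> y"
    if "x \<in> carrier A" "y \<in> carrier A" "z \<in> carrier A" for x y z
  proof
    fix w
    have "(z \<otimes>\<^bsub>A\<^esub> (x \<oplus>\<^bsub>A\<^esub> y)) w = (\<Oplus>i\<in>{..length w}. z (take i w) \<otimes> x (drop i w) \<oplus> z (take i w) \<otimes> y (drop i w))"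
      unfolding coeff_mult using that by (intro finsum_cong') (auto simp: r_distr)
    also have "\<dots> = (z \<otimes>\<^bsub>A\<^esub> x \<oplus>\<^bsub>A\<^esub> z \<otimes>\<^bsub>A\<^esub> y) w"
      unfolding coeff_add coeff_mult using that by (intro finsum_addf) auto
    finally show "(z \<otimes>\<^bsub>A\<^esub> (x \<oplus>\<^bsub>A\<^esub> y)) w = (z \<otimes>\<^bsub>A\<^esub> x \<oplus>\<^bsub>A\<^esub> z \<otimes>\<^bsub>A\<^esub> y) w" .
  qed
qed

sublocale A: ring "free_algebra F d"
  by (rule free_algebra_ring)

lemma coeff_uminus [simp]: "p \<in> carrier A \<Longrightarrow> (\<ominus>\<^bsub>A\<^esub> p) w = \<ominus> p w"
  using A.r_neg[of p] coeff_add[of p "\<ominus>\<^bsub>A\<^esub> p" w]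
  by (metis A.a_inv_closed coeff_closed coeff_zero minus_equality a_comm)

lemma coeff_minus [simp]:
  "p \<in> carrier A \<Longrightarrow> q \<in> carrier A \<Longrightarrow> (p \<ominus>\<^bsub>A\<^esub> q) w = p w \<ominus> q w"
  by (simp add: a_minus_def)

lemma monomial_mult:
  assumes "c \<in> carrier F" "c' \<in> carrier F" "u \<in> lists {..<d}" "u' \<in> lists {..<d}"
  shows "monomial F c u \<otimes>\<^bsub>A\<^esub> monomial F c' u' = monomial F (c \<otimes> c') (u @ u')"
proof
  fix w
  show "(monomial F c u \<otimes>\<^bsub>A\<^esub> monomial F c' u') w = monomial F (c \<otimes> c') (u @ u') w"
  proof (cases "w = u @ u'")
    case True
    then show ?thesis
      using coeff_mult_monomial_left[of "monomial F c' u'" c u u'] assms monomial_closed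
      by (simp add: monomial_def)
  next
    case False
    have "(monomial F c u \<otimes>\<^bsub>A\<^esub> monomial F c' u') w = \<zero>"
    proof (rule ccontr)
      assume "(monomial F c u \<otimes>\<^bsub>A\<^esub> monomial F c' u') w \<noteq> \<zero>"
      then obtain x y where "w = x @ y" "monomial F c u x \<noteq> \<zero>" "monomial F c' u' y \<noteq> \<zero>"
        using coeff_mult_nonzero monomial_closed assms by metis
      then show False using False by (auto simp: monomial_def split: if_splits)
    qed
    then show ?thesis using False by (simp add: monomial_def)
  qed
qed

text \<open>An element is the finite sum of its monomials; the induction adds them up one word at a
  time.\<close>

lemma mem_if_monomials:
  assumes p: "p \<in> carrier A" and "\<zero>\<^bsub>A\<^esub> \<in> H"
    and add: "\<And>x y. \<lbrakk>x \<in> H; y \<in> H\<rbrakk> \<Longrightarrow> x \<oplus>\<^bsub>A\<^esub> y \<in> H"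
    and mono: "\<And>w. p w \<noteq> \<zero> \<Longrightarrow> monomial F (p w) w \<in> H"
  shows "p \<in> H"
proof -
  have "(\<lambda>w. if w \<in> T then p w else \<zero>) \<in> H" if "finite T" "T \<subseteq> supp p" for T
    using that
  proof (induction T rule: finite_induct)
    case empty
    have "(\<lambda>w. if w \<in> {} then p w else \<zero>) = \<zero>\<^bsub>A\<^esub>" by auto
    then show ?case using assms(2) by simp
  next
    case (insert u T)
    have "(\<lambda>w. if w \<in> insert u T then p w else \<zero>)
        = monomial F (p u) u \<oplus>\<^bsub>A\<^esub> (\<lambda>w. if w \<in> T then p w else \<zero>)"
      using insert.hyps p by (auto simp: monomial_def)
    then show ?case using insert mono add by auto
  qed
  from this[of "supp p"] have "(\<lambda>w. if w \<in> supp p then p w else \<zero>) \<in> H"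
    using p by (auto simp: free_carrier_iff)
  moreover have "(\<lambda>w. if w \<in> supp p then p w else \<zero>) = p" by auto
  ultimately show ?thesis by simp
qed

lemma monomial_mem_ideal:
  assumes "ideal J A" "c \<in> carrier F" "u \<in> lists {..<d}" "monomial F \<one> u \<in> J"
  shows "monomial F c u \<in> J"
proof -
  interpret ideal J A by fact
  have "monomial F c [] \<otimes>\<^bsub>A\<^esub> monomial F \<one> u \<in> J"
    using assms by (intro I_l_closed monomial_closed) auto
  then show ?thesis using assms by (simp add: monomial_mult)
qed

end

section \<open>The ideal generated by the words outside \<open>L\<close>\<close>

locale monomial_algebra_field = free_algebra_field F d + factorial_language d L
  for F :: "('a, 'b) ring_scheme" (structure) and d and L
begin

definition I :: "(nat list \<Rightarrow> 'a) set" where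
  "I = monomial_ideal F d (lists {..<d} - L)"

text \<open>Since \<open>L\<close> is closed under factors, the elements that vanish on
  \<open>L\<close> form an ideal, and it contains the generators of \<open>I\<close>. Conversely,
  such an element is a combination of words outside \<open>L\<close>.\<close>

lemma mem_I_iff: "p \<in> I \<longleftrightarrow> p \<in> carrier A \<and> (\<forall>w\<in>L. p w = \<zero>)"
  and ideal_I: "ideal I A"
proof -
  have word: "word_monomial F u = monomial F \<one> u" for u
    by (simp add: word_monomial_def monomial_def)
  let ?N = "{p \<in> carrier A. \<forall>w\<in>L. p w = \<zero>}"
  have "ideal ?N A"
  proof (rule idealI[OF free_algebra_ring])
    show "subgroup ?N (add_monoid A)"
      by (rule A.add.subgroupI) (auto simp flip: a_inv_def)
    show "x \<otimes>\<^bsub>A\<^esub> p \<in> ?N" "p \<otimes>\<^bsub>A\<^esub> x \<in> ?N" if "p \<in> ?N" "x \<in> carrier A" for p x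
    proof -
      have "(x \<otimes>\<^bsub>A\<^esub> p) w = \<zero>" "(p \<otimes>\<^bsub>A\<^esub> x) w = \<zero>" if w: "w \<in> L" for w
        using coeff_mult_nonzero[of x p w] coeff_mult_nonzero[of p x w]
          factor_closed[OF w] \<open>p \<in> ?N\<close> \<open>x \<in> carrier A\<close> by auto
      then show "x \<otimes>\<^bsub>A\<^esub> p \<in> ?N" "p \<otimes>\<^bsub>A\<^esub> x \<in> ?N" using that by auto
    qed
  qed
  moreover have W: "word_monomial F ` (lists {..<d} - L) \<subseteq> ?N"
    unfolding word using monomial_closed by (auto simp: monomial_def)
  ultimately have "I \<subseteq> ?N"
    unfolding I_def monomial_ideal_def by (rule A.genideal_minimal)
  have WA: "word_monomial F ` (lists {..<d} - L) \<subseteq> carrier A" using W by blast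
  then show ideal: "ideal I A"
    unfolding I_def monomial_ideal_def by (rule A.genideal_ideal)
  interpret I: ideal I A by (rule ideal)
  have "p \<in> I" if p: "p \<in> ?N" for p
  proof (rule mem_if_monomials)
    fix w assume "p w \<noteq> \<zero>"
    then have w: "w \<in> lists {..<d} - L" using p by (auto simp: free_carrier_iff)
    then have "monomial F \<one> w \<in> I"
      using A.genideal_self[OF WA] unfolding I_def monomial_ideal_def word[symmetric] by blast
    then show "monomial F (p w) w \<in> I" using monomial_mem_ideal[OF ideal] p w by simp
  qed (use p in auto)
  then show "p \<in> I \<longleftrightarrow> p \<in> carrier A \<and> (\<forall>w\<in>L. p w = \<zero>)"
    using \<open>I \<subseteq> ?N\<close> by blast
qed

sublocale I: ideal I "free_algebra F d"
  by (rule ideal_I)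

section \<open>The sum of the letters\<close>

definition letter_sum :: "nat list \<Rightarrow> 'a" where
  "letter_sum = (\<lambda>w. if w \<in> lists {..<d} \<and> length w = 1 then \<one> else \<zero>)"

lemma letter_sum_closed: "letter_sum \<in> carrier A"
  unfolding free_carrier_iff letter_sum_def
  using finite_lists_length_eq[of "{..<d}" 1] by (auto elim: rev_finite_subset)

lemma coeff_mult_letter_sum:
  assumes "p \<in> carrier A" "x < d"
  shows "(p \<otimes>\<^bsub>A\<^esub> letter_sum) (w @ [x]) = p w"
proof -
  have "(p \<otimes>\<^bsub>A\<^esub> letter_sum) (w @ [x])
      = p (take (length w) (w @ [x])) \<otimes> letter_sum (drop (length w) (w @ [x]))"
    unfolding coeff_mult
    using assms letter_sum_closed by (intro finsum_single) (auto simp: letter_sum_def)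
  then show ?thesis using assms by (simp add: letter_sum_def)
qed

lemma coeff_mult_letter_sum_Nil: "p \<in> carrier A \<Longrightarrow> (p \<otimes>\<^bsub>A\<^esub> letter_sum) [] = \<zero>"
  by (simp add: coeff_mult letter_sum_def)

text \<open>Comparing coefficients on \<open>L\<close> gives \<open>p [] = \<one>\<close> and
  \<open>p (w @ [x]) = p w\<close>, so \<open>p\<close> is \<open>\<one>\<close> on all of
  \<open>L\<close>. The support of \<open>p\<close> is finite.\<close>

lemma one_minus_letter_sum_not_left_invertible:
  assumes p: "p \<in> carrier A" and inv: "p \<otimes>\<^bsub>A\<^esub> (\<one>\<^bsub>A\<^esub> \<ominus>\<^bsub>A\<^esub> letter_sum) \<ominus>\<^bsub>A\<^esub> \<one>\<^bsub>A\<^esub> \<in> I"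
  shows "finite L"
proof -
  have *: "p \<otimes>\<^bsub>A\<^esub> (\<one>\<^bsub>A\<^esub> \<ominus>\<^bsub>A\<^esub> letter_sum) = p \<ominus>\<^bsub>A\<^esub> p \<otimes>\<^bsub>A\<^esub> letter_sum"
    using p letter_sum_closed by (simp add: a_minus_def A.r_distr A.r_minus)
  have eq: "p w \<ominus> (p \<otimes>\<^bsub>A\<^esub> letter_sum) w = \<one>\<^bsub>A\<^esub> w" if "w \<in> L" for w
  proof -
    have "(p \<ominus>\<^bsub>A\<^esub> p \<otimes>\<^bsub>A\<^esub> letter_sum \<ominus>\<^bsub>A\<^esub> \<one>\<^bsub>A\<^esub>) w = \<zero>"
      using inv that unfolding mem_I_iff * by blast
    moreover have "(p \<ominus>\<^bsub>A\<^esub> p \<otimes>\<^bsub>A\<^esub> letter_sum \<ominus>\<^bsub>A\<^esub> \<one>\<^bsub>A\<^esub>) w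
        = (p w \<ominus> (p \<otimes>\<^bsub>A\<^esub> letter_sum) w) \<ominus> \<one>\<^bsub>A\<^esub> w"
      using p letter_sum_closed by (subst coeff_minus) (simp_all add: coeff_minus)
    ultimately show ?thesis using p letter_sum_closed by simp
  qed
  have "p w = \<one>" if "w \<in> L" for w
    using that
  proof (induction w rule: rev_induct)
    case Nil
    then show ?case using eq[of "[]"] p by (simp add: coeff_mult_letter_sum_Nil free_one monomial_def a_minus_def)
  next
    case (snoc x w)
    have "w \<in> L" using snoc.prems factor_closed by blast
    moreover have "x < d" using snoc.prems L_lists by auto
    ultimately show ?case
      using eq[OF snoc.prems] snoc.IH p
      by (simp add: coeff_mult_letter_sum free_one monomial_def r_right_minus_eq)
  qed
  then have "L \<subseteq> supp p" by auto
  then show ?thesis using p unfolding free_carrier_iff by (meson finite_subset)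
qed

lemma letter_sum_pow:
  "(letter_sum [^]\<^bsub>A\<^esub> (n::nat)) w \<noteq> \<zero> \<Longrightarrow> length w = n"
proof (induction n arbitrary: w)
  case 0
  then show ?case by (auto simp: free_one monomial_def split: if_splits)
next
  case (Suc n)
  then have "(letter_sum [^]\<^bsub>A\<^esub> n \<otimes>\<^bsub>A\<^esub> letter_sum) w \<noteq> \<zero>" by simp
  then obtain u v where uv: "w = u @ v" "(letter_sum [^]\<^bsub>A\<^esub> n) u \<noteq> \<zero>" "letter_sum v \<noteq> \<zero>"
    using coeff_mult_nonzero[of "letter_sum [^]\<^bsub>A\<^esub> n" letter_sum w] letter_sum_closed A.nat_pow_closed
    by blast
  have "length u = n" using Suc.IH uv(2) by blast
  moreover have "length v = 1" using uv(3) unfolding letter_sum_def by presburger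
  ultimately show ?case using uv(1) by simp
qed

end

section \<open>Growth of filtered algebras\<close>

context ring
begin

text \<open>The elements that left multiplication by \<open>y\<close> sends into \<open>Q\<close>
  form a subgroup, so it is enough to check generators.\<close>

lemma generate_mult_left:
  assumes Q: "subgroup Q (add_monoid R)" and "H \<subseteq> carrier R" "y \<in> carrier R"
    and "\<And>h. h \<in> H \<Longrightarrow> y \<otimes> h \<in> Q" and x: "x \<in> generate (add_monoid R) H"
  shows "y \<otimes> x \<in> Q"
proof -
  have "subgroup {z \<in> carrier R. y \<otimes> z \<in> Q} (add_monoid R)"
    using add.subgroupE[OF Q] assms(3) subgroup.one_closed[OF Q]
    by (intro add.subgroupI) (auto simp: r_distr r_minus simp flip: a_inv_def)
  then have "generate (add_monoid R) H \<subseteq> {z \<in> carrier R. y \<otimes> z \<in> Q}"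
    using assms by (intro add.generate_subgroup_incl) auto
  then show ?thesis using x by blast
qed

lemma dim_mono:
  assumes K: "subfield K R" and "subalgebra K U R" "finite_dimension K W" "U \<subseteq> W"
  shows "(dim over K) U \<le> (dim over K) W"
proof -
  have "finite_dimension K U" using subalbegra_incl_imp_finite_dimension[OF K] assms by blast
  then have "dimension ((dim over K) U) K U" by (rule finite_dimensionE[OF K])
  then obtain Us where "independent K Us" "length Us = (dim over K) U" "Span K Us = U" "set Us \<subseteq> carrier R"
    using exists_base[OF K] by metis
  moreover have "set Us \<subseteq> W"
    using Span_base_incl[OF K] calculation assms(4) by blast
  ultimately show ?thesis
    using independent_length_le_dimension[OF K finite_dimensionE[OF K assms(3)]] by metis
qed

end

text \<open>Abstracts the filtration of a monomial algebra by word length: exhaustive,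
  multiplicative, with finite-dimensional pieces, and generated in degree one. Growth can then be
  compared with the dimensions of the \<open>E n\<close>.\<close>

locale filtered_algebra = ring R for R (structure) +
  fixes K :: "'a set" and E :: "nat \<Rightarrow> 'a set"
  assumes K: "subfield K R"
    and central: "\<lbrakk>k \<in> K; x \<in> carrier R\<rbrakk> \<Longrightarrow> x \<otimes> k = k \<otimes> x"
    and E_subalgebra: "subalgebra K (E n) R"
    and E_finite: "finite_dimension K (E n)"
    and E_mono: "m \<le> n \<Longrightarrow> E m \<subseteq> E n"
    and E_zero: "E 0 = K"
    and E_mult: "\<lbrakk>x \<in> E m; y \<in> E n\<rbrakk> \<Longrightarrow> x \<otimes> y \<in> E (m + n)"
    and E_exhausts: "x \<in> carrier R \<Longrightarrow> \<exists>n. x \<in> E n"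
    and E_degree_one: "E (Suc n) \<subseteq> generate (add_monoid R) (E n <#> E 1)"
begin

lemma K_carrier: "K \<subseteq> carrier R"
  using K by (simp add: subfieldE(3))

lemma E_carrier: "E n \<subseteq> carrier R"
  using subalgebra_in_carrier[OF E_subalgebra] .

lemma E_subgroup: "subgroup (E n) (add_monoid R)"
  using E_subalgebra by (rule subalgebra.axioms(1))

text \<open>Each element of a finite spanning family lies in some \<open>G n\<close>. The sum of the
  indices bounds them all, and \<open>Suc\<close> makes the result positive.\<close>

lemma fd_subset_exhaustion:
  assumes V: "finite_dimension K V"
    and G: "\<And>n. subalgebra K (G n) R" "\<And>n. G n \<subseteq> G (Suc n)" "V \<subseteq> (\<Union>n. G n)"
  shows "\<exists>n\<ge>1. V \<subseteq> G n"
proof -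
  obtain n where "dimension n K V" using V by blast
  then obtain Us where Us: "set Us \<subseteq> carrier R" "Span K Us = V"
    using exists_base[OF K] by metis
  then have "set Us \<subseteq> (\<Union>n. G n)" using Span_base_incl[OF K] G(3) by blast
  then obtain \<nu> where \<nu>: "\<And>u. u \<in> set Us \<Longrightarrow> u \<in> G (\<nu> u)" by (metis UN_iff subsetD)
  define m where "m = Suc (\<Sum>u\<in>set Us. \<nu> u)"
  have "set Us \<subseteq> G m"
  proof
    fix u assume u: "u \<in> set Us"
    then have "\<nu> u \<le> m" using member_le_sum[of u "set Us" \<nu>] by (simp add: m_def)
    then show "u \<in> G m" using \<nu>[OF u] lift_Suc_mono_le[of G, OF G(2)] by blast
  qed
  then have "V \<subseteq> G m" using subalgebra_Span_incl[OF K G(1)] Us(2) by blast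
  then show ?thesis by (intro exI[of _ m]) (simp add: m_def)
qed

lemma fd_generating_E_one: "fd_generating_subspace R K (E 1)"
proof -
  have "E n \<subseteq> generate_ring R (K \<union> E 1)" for n
  proof (induction n)
    case 0
    then show ?case by (auto simp: E_zero intro: generate_ring.incl)
  next
    case (Suc n)
    have sub: "subring (generate_ring R (K \<union> E 1)) R"
      using K_carrier E_carrier by (intro generate_ring_is_subring) auto
    have "E n <#> E 1 \<subseteq> generate_ring R (K \<union> E 1)"
      using Suc by (auto simp: set_mult_def intro!: generate_ring.eng_mult intro: generate_ring.incl)
    then have "generate (add_monoid R) (E n <#> E 1) \<subseteq> generate_ring R (K \<union> E 1)"
      using subring.axioms(1)[OF sub] by (intro add.generate_subgroup_incl)
    then show ?case using E_degree_one by blast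
  qed
  then have "carrier R \<subseteq> generate_ring R (K \<union> E 1)" using E_exhausts by blast
  moreover have "generate_ring R (K \<union> E 1) \<subseteq> carrier R"
    using K_carrier E_carrier by (intro generate_ring_incl) auto
  ultimately show ?thesis
    unfolding fd_generating_subspace_def using E_subalgebra E_finite by blast
qed

section \<open>Powers of a generating subspace compared with the filtration\<close>

context
  fixes V
  assumes V: "fd_generating_subspace R K V"
begin

abbreviation "P \<equiv> subspace_power R K V"
abbreviation "G \<equiv> growth_space R K V"

lemma V_subalgebra: "subalgebra K V R" and V_finite: "finite_dimension K V"
  and V_generates: "generate_ring R (K \<union> V) = carrier R"
  using V unfolding fd_generating_subspace_def by auto

lemma V_carrier: "V \<subseteq> carrier R"
  using subalgebra_in_carrier[OF V_subalgebra] .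

lemma P_subgroup: "subgroup (P n) (add_monoid R)"
proof (induction n)
  case 0
  then show ?case using subfieldE(1)[OF K] by (simp add: subring.axioms(1) subcringE subcring.axioms(1))
next
  case (Suc n)
  have "P n <#> V \<subseteq> carrier R"
    using subgroup.subset[OF Suc] V_carrier by (auto simp: set_mult_def)
  then show ?case by (simp add: add.generate_is_subgroup)
qed

lemma P_carrier: "P n \<subseteq> carrier R"
  using subgroup.subset[OF P_subgroup] by simp

lemma PV_carrier: "P n <#> V \<subseteq> carrier R"
  using P_carrier V_carrier by (auto simp: set_mult_def)

lemma P_Suc_incl: "\<lbrakk>p \<in> P n; v \<in> V\<rbrakk> \<Longrightarrow> p \<otimes> v \<in> P (Suc n)"
  by (auto simp: set_mult_def intro!: generate.incl)

lemma P_smult: "\<lbrakk>k \<in> K; x \<in> P n\<rbrakk> \<Longrightarrow> k \<otimes> x \<in> P n"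
proof (induction n arbitrary: x)
  case 0
  then show ?case using subringE(6)[of K R] subfieldE(1)[OF K] by (simp add: subcring.axioms(1))
next
  case (Suc n)
  show ?case
  proof (rule generate_mult_left[OF P_subgroup PV_carrier])
    show "k \<in> carrier R" using Suc.prems K_carrier by blast
    show "x \<in> generate (add_monoid R) (P n <#> V)" using Suc.prems by simp
    fix h assume "h \<in> P n <#> V"
    then obtain p v where h: "p \<in> P n" "v \<in> V" "h = p \<otimes> v" by (auto simp: set_mult_def)
    then have "k \<otimes> h = (k \<otimes> p) \<otimes> v"
      using Suc.prems K_carrier P_carrier V_carrier by (simp add: m_assoc subset_iff)
    then show "k \<otimes> h \<in> P (Suc n)" using P_Suc_incl Suc.IH[OF Suc.prems(1) h(1)] h(2) by simp
  qed
qed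

text \<open>Induction on the right factor, one element of \<open>V\<close> at a time. For
  \<open>n = 0\<close> the right factor is a scalar and moves to the left by
  \<open>central\<close>.\<close>

lemma P_mult: "\<lbrakk>x \<in> P m; y \<in> P n\<rbrakk> \<Longrightarrow> x \<otimes> y \<in> P (m + n)"
proof (induction n arbitrary: y)
  case 0
  then have "y \<in> K" "x \<in> carrier R" using P_carrier[of m] by auto
  then show ?case using central[of y x] P_smult[of y x m] 0 by simp
next
  case (Suc n)
  show ?case
  proof (rule generate_mult_left[OF P_subgroup PV_carrier])
    show "x \<in> carrier R" using Suc.prems P_carrier by blast
    show "y \<in> generate (add_monoid R) (P n <#> V)" using Suc.prems by simp
    fix h assume "h \<in> P n <#> V"
    then obtain p v where h: "p \<in> P n" "v \<in> V" "h = p \<otimes> v" by (auto simp: set_mult_def)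
    then have "x \<otimes> h = (x \<otimes> p) \<otimes> v"
      using Suc.prems P_carrier V_carrier by (simp add: m_assoc subset_iff)
    then show "x \<otimes> h \<in> P (m + Suc n)"
      using P_Suc_incl[OF Suc.IH[OF Suc.prems(1) h(1)] h(2)] by simp
  qed
qed

lemma G_Suc_iff: "x \<in> G (Suc n) \<longleftrightarrow> (\<exists>a\<in>G n. \<exists>b\<in>P (Suc n). x = a \<oplus> b)"
  by (simp add: set_add_def')

declare growth_space.simps(2) [simp del] subspace_power.simps(2) [simp del]

lemma G_subalgebra: "subalgebra K (G n) R"
proof (induction n)
  case 0
  then show ?case using P_subgroup[of 0] P_smult[of _ _ 0]
    by (auto intro!: subalgebra.intro subalgebra_axioms.intro)
next
  case (Suc n)
  have G: "G n \<subseteq> carrier R" using subalgebra_in_carrier[OF Suc] .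
  show ?case
  proof (intro subalgebra.intro subalgebra_axioms.intro)
    have "additive_subgroup (G n <+> P (Suc n)) R"
      using add_additive_subgroups Suc P_subgroup
      by (simp add: additive_subgroup.intro subalgebra.axioms(1))
    then show "subgroup (G (Suc n)) (add_monoid R)"
      unfolding growth_space.simps by (rule additive_subgroup.a_subgroup)
    fix k x assume k: "k \<in> K" and "x \<in> G (Suc n)"
    then obtain a b where ab: "a \<in> G n" "b \<in> P (Suc n)" "x = a \<oplus> b" unfolding G_Suc_iff by blast
    then have "k \<otimes> x = k \<otimes> a \<oplus> k \<otimes> b"
      using k K_carrier G P_carrier by (simp add: r_distr subset_iff)
    moreover have "k \<otimes> a \<in> G n" using subalgebra.smult_closed[OF Suc k] ab(1) .
    moreover have "k \<otimes> b \<in> P (Suc n)" using P_smult[OF k ab(2)] .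
    ultimately show "k \<otimes> x \<in> G (Suc n)" unfolding G_Suc_iff by blast
  qed
qed

lemma G_subgroup: "subgroup (G n) (add_monoid R)"
  using G_subalgebra by (rule subalgebra.axioms(1))

lemma G_carrier: "G n \<subseteq> carrier R"
  using subalgebra_in_carrier[OF G_subalgebra] .

lemma G_mono_Suc: "G n \<subseteq> G (Suc n)"
proof
  fix x assume "x \<in> G n"
  moreover have "\<zero> \<in> P (Suc n)" using subgroup.one_closed[OF P_subgroup] by simp
  moreover have "x = x \<oplus> \<zero>" using \<open>x \<in> G n\<close> G_carrier by (simp add: subset_iff)
  ultimately show "x \<in> G (Suc n)" unfolding G_Suc_iff by blast
qed

lemma G_mono: "m \<le> n \<Longrightarrow> G m \<subseteq> G n"
  using G_mono_Suc by (rule lift_Suc_mono_le)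

lemma P_subset_G: "P n \<subseteq> G n"
proof (cases n)
  case (Suc m)
  show ?thesis
  proof
    fix x assume "x \<in> P n"
    moreover have "\<zero> \<in> G m" using subgroup.one_closed[OF G_subgroup] by simp
    moreover have "x = \<zero> \<oplus> x" using \<open>x \<in> P n\<close> P_carrier by (simp add: subset_iff)
    ultimately show "x \<in> G n" unfolding Suc G_Suc_iff by blast
  qed
qed simp

lemma P_G_mult: "\<lbrakk>x \<in> P m; y \<in> G n\<rbrakk> \<Longrightarrow> x \<otimes> y \<in> G (m + n)"
proof (induction n arbitrary: y)
  case 0
  then show ?case using P_mult[of x m y 0] P_subset_G by auto
next
  case (Suc n)
  then obtain a b where ab: "a \<in> G n" "b \<in> P (Suc n)" "y = a \<oplus> b" unfolding G_Suc_iff by blast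
  then have "x \<otimes> y = x \<otimes> a \<oplus> x \<otimes> b"
    using Suc.prems P_carrier G_carrier by (simp add: r_distr subset_iff)
  moreover have "x \<otimes> a \<in> G (m + n)" using Suc.IH Suc.prems ab by blast
  moreover have "x \<otimes> b \<in> P (Suc (m + n))" using P_mult[OF Suc.prems(1) ab(2)] by simp
  ultimately show ?case using G_Suc_iff[of _ "m + n"] by auto
qed

lemma G_mult: "\<lbrakk>x \<in> G m; y \<in> G n\<rbrakk> \<Longrightarrow> x \<otimes> y \<in> G (m + n)"
proof (induction m arbitrary: x)
  case 0
  then show ?case using P_G_mult[of x 0 y n] by simp
next
  case (Suc m)
  then obtain a b where ab: "a \<in> G m" "b \<in> P (Suc m)" "x = a \<oplus> b" unfolding G_Suc_iff by blast
  then have "x \<otimes> y = a \<otimes> y \<oplus> b \<otimes> y"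
    using Suc.prems P_carrier G_carrier by (simp add: l_distr subset_iff)
  moreover have "a \<otimes> y \<in> G (Suc m + n)" using Suc.IH Suc.prems ab G_mono_Suc[of "m + n"] by auto
  moreover have "b \<otimes> y \<in> G (Suc m + n)" using P_G_mult[OF ab(2) Suc.prems(2)] .
  ultimately show ?case using add.subgroupE(4)[OF G_subgroup] by simp
qed

text \<open>The union of the \<open>G n\<close> contains \<open>K\<close> and \<open>V\<close> and
  is closed under the ring operations; for products this is \<open>G_mult\<close>.\<close>

lemma G_exhausts: "carrier R \<subseteq> (\<Union>n. G n)"
proof
  fix x assume "x \<in> carrier R"
  then have "x \<in> generate_ring R (K \<union> V)" using V_generates by simp
  then show "x \<in> (\<Union>n. G n)"
  proof (induction rule: generate_ring.induct)
    case one
    have "\<one> \<in> G 0" using subringE(3)[of K R] subfieldE(1)[OF K] by (simp add: subcring.axioms(1))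
    then show ?case by blast
  next
    case (incl h)
    then show ?case
    proof
      assume "h \<in> K"
      then have "h \<in> G 0" by simp
      then show ?thesis by blast
    next
      assume h: "h \<in> V"
      \<comment> \<open>The first power is generated by the products of \<open>K\<close> with
        \<open>V\<close>, so \<open>h\<close> has to be written as
        \<open>\<one> \<otimes> h\<close>.\<close>
      have "\<one> \<in> P 0" using subringE(3)[of K R] subfieldE(1)[OF K] by (simp add: subcring.axioms(1))
      then have "\<one> \<otimes> h \<in> P 1" using P_Suc_incl[of \<one> 0 h] h by simp
      moreover have "\<one> \<otimes> h = h" using h V_carrier by (simp add: subset_iff)
      ultimately have "h \<in> G 1" using P_subset_G[of 1] by (simp only: subset_iff)
      then show ?thesis by blast
    qed
  next
    case (a_inv h)
    then show ?case using add.subgroupE(3)[OF G_subgroup] by (auto simp: a_inv_def)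
  next
    case (eng_add h1 h2)
    then obtain m n where "h1 \<in> G m" "h2 \<in> G n" by blast
    then have "h1 \<in> G (max m n)" "h2 \<in> G (max m n)" using G_mono by (meson max.cobounded1 max.cobounded2 subsetD)+
    then show ?case using add.subgroupE(4)[OF G_subgroup] by auto
  next
    case (eng_mult h1 h2)
    then show ?case using G_mult by blast
  qed
qed

lemma P_subset_E:
  assumes "V \<subseteq> E s"
  shows "P n \<subseteq> E (s * n)"
proof (induction n)
  case 0
  then show ?case by (simp add: E_zero)
next
  case (Suc n)
  have "P n <#> V \<subseteq> E (s * Suc n)"
    using E_mult Suc assms by (fastforce simp: set_mult_def add.commute)
  then show ?case unfolding subspace_power.simps
    by (intro add.generate_subgroup_incl E_subgroup)
qed

lemma G_subset_E:
  assumes "V \<subseteq> E s"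
  shows "G n \<subseteq> E (s * n)"
proof (induction n)
  case 0
  then show ?case by (simp add: E_zero)
next
  case (Suc n)
  have "a \<oplus> b \<in> E (s * Suc n)" if "a \<in> G n" "b \<in> P (Suc n)" for a b
  proof (rule add.subgroupE(4)[OF E_subgroup, simplified])
    show "a \<in> E (s * Suc n)" using that Suc E_mono[of "s * n" "s * Suc n"] by auto
    show "b \<in> E (s * Suc n)" using that P_subset_E[OF assms] by blast
  qed
  then show ?case unfolding subset_iff G_Suc_iff by blast
qed

lemma E_subset_G:
  assumes "E 1 \<subseteq> G t"
  shows "E n \<subseteq> G (t * n)"
proof (induction n)
  case 0
  then show ?case by (simp add: E_zero)
next
  case (Suc n)
  have "E n <#> E 1 \<subseteq> G (t * Suc n)"
    using G_mult Suc assms by (fastforce simp: set_mult_def add.commute)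
  then have "generate (add_monoid R) (E n <#> E 1) \<subseteq> G (t * Suc n)"
    by (intro add.generate_subgroup_incl G_subgroup)
  then show ?case using E_degree_one by blast
qed

text \<open>By finite dimension \<open>V \<subseteq> E s\<close> and
  \<open>E 1 \<subseteq> G t\<close> for some \<open>s\<close> and \<open>t\<close>. Taking powers
  gives \<open>G n \<subseteq> E (s * n)\<close> and \<open>E n \<subseteq> G (t * n)\<close>, and
  the constant \<open>s * t\<close> serves for both.\<close>

lemma growth_function_bounds:
  "\<exists>s\<ge>1. \<forall>n. growth_function R K V n \<le> (dim over K) (E (s * n)) \<and>
     (dim over K) (E n) \<le> growth_function R K V (s * n)"
proof -
  have VE: "V \<subseteq> (\<Union>n. E n)" using E_exhausts V_carrier by blast
  have E_mono_Suc: "E n \<subseteq> E (Suc n)" for n by (rule E_mono) simp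
  obtain s where s: "s \<ge> 1" "V \<subseteq> E s"
    using fd_subset_exhaustion[OF V_finite E_subalgebra E_mono_Suc VE] by blast
  have EG: "E 1 \<subseteq> (\<Union>n. G n)" using G_exhausts E_carrier by blast
  obtain t where t: "t \<ge> 1" "E 1 \<subseteq> G t"
    using fd_subset_exhaustion[OF E_finite G_subalgebra G_mono_Suc EG] by blast
  have G_fin: "finite_dimension K (G n)" for n
    using subalbegra_incl_imp_finite_dimension[OF K E_finite G_subalgebra G_subset_E[OF s(2)]] .
  have "(dim over K) (G n) \<le> (dim over K) (E (s * t * n))" for n
  proof (rule dim_mono[OF K G_subalgebra E_finite])
    have "s * n \<le> s * t * n" using t(1) by simp
    then show "G n \<subseteq> E (s * t * n)" using G_subset_E[OF s(2)] E_mono by blast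
  qed
  moreover have "(dim over K) (E n) \<le> (dim over K) (G (s * t * n))" for n
  proof (rule dim_mono[OF K E_subalgebra G_fin])
    have "t * n \<le> s * t * n" using s(1) by simp
    then show "E n \<subseteq> G (s * t * n)" using E_subset_G[OF t(2)] G_mono by blast
  qed
  moreover have "s * t \<ge> 1" using s(1) t(1) by simp
  ultimately show ?thesis unfolding growth_function_def over_def by blast
qed

end

end

section \<open>Primitivity and growth of monomial algebras\<close>

context monomial_algebra_field
begin

abbreviation "B \<equiv> monomial_algebra F d (lists {..<d} - L)"

abbreviation \<pi> :: "(nat list \<Rightarrow> 'a) \<Rightarrow> (nat list \<Rightarrow> 'a) set" where
  "\<pi> \<equiv> (+>\<^bsub>A\<^esub>) I"

lemma B_eq: "B = A Quot I"
  by (simp add: monomial_algebra_def I_def)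

sublocale \<pi>: ring_hom_ring "free_algebra F d" "monomial_algebra F d (lists {..<d} - L)" \<pi>
  unfolding B_eq by (rule I.rcos_ring_hom_ring)

lemma \<pi>_surj: "x \<in> carrier B \<Longrightarrow> \<exists>p\<in>carrier A. x = \<pi> p"
  unfolding B_eq by (auto simp: FactRing_def A_RCOSETS_def')

lemma B_zero: "\<zero>\<^bsub>B\<^esub> = I"
  unfolding B_eq by (simp add: FactRing_def)

lemma \<pi>_eq_zero_iff: "p \<in> carrier A \<Longrightarrow> \<pi> p = \<zero>\<^bsub>B\<^esub> \<longleftrightarrow> p \<in> I"
  unfolding B_zero using I.rcos_const_imp_mem A.a_rcos_zero[OF ideal_I] by blast

lemma \<pi>_eq_iff:
  assumes "p \<in> carrier A" "q \<in> carrier A"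
  shows "\<pi> p = \<pi> q \<longleftrightarrow> p \<ominus>\<^bsub>A\<^esub> q \<in> I"
proof -
  have "\<pi> (p \<ominus>\<^bsub>A\<^esub> q) = \<pi> p \<ominus>\<^bsub>B\<^esub> \<pi> q"
    using assms by (simp add: a_minus_def)
  then show ?thesis
    using \<pi>_eq_zero_iff[of "p \<ominus>\<^bsub>A\<^esub> q"] \<pi>.S.r_right_minus_eq[of "\<pi> p" "\<pi> q"] assms by simp
qed

lemma monomial_mem_I: "c \<in> carrier F \<Longrightarrow> u \<in> lists {..<d} \<Longrightarrow> u \<notin> L \<Longrightarrow> monomial F c u \<in> I"
  unfolding mem_I_iff using monomial_closed by (auto simp: monomial_def)

lemma L_in_lists: "u \<in> L \<Longrightarrow> u \<in> lists {..<d}"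
  using L_lists by blast

end

section \<open>Ideals and primitivity\<close>

locale recurrent_monomial_algebra = monomial_algebra_field F d L + recurrent_language d L
  for F :: "('a, 'b) ring_scheme" (structure) and d and L
begin

lemma infinite_L: "infinite L"
proof
  assume "finite L"
  then have "finite (length ` L)" by simp
  then obtain M where M: "\<And>w. w \<in> L \<Longrightarrow> length w \<le> M"
    using finite_nat_set_iff_bounded_le by auto
  obtain w where "w \<in> L" "Suc M \<le> length w" using ex_long by blast
  then show False using M[of w] by simp
qed

text \<open>
  An element with fewest words of \<open>L\<close> in its support has only one: if there were two, a context
  admitting only one of them would shorten it.
\<close>
lemma ideal_contains_word:
  assumes J: "ideal J A" and "I \<subset> J"
  shows "\<exists>u\<in>L. monomial F \<one> u \<in> J"
proof -
  interpret J: ideal J A by (rule J)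
  define T where "T p = {w \<in> L. p w \<noteq> \<zero>}" for p :: "nat list \<Rightarrow> 'a"
  have fin: "finite (T p)" if "p \<in> carrier A" for p
    using that unfolding T_def free_carrier_iff by (auto elim: rev_finite_subset)
  have JA: "p \<in> carrier A" if "p \<in> J" for p using that J.a_subset by blast
  obtain a0 where "a0 \<in> J - I" using \<open>I \<subset> J\<close> by blast
  then obtain a where a: "a \<in> J - I" and min: "\<And>b. b \<in> J - I \<Longrightarrow> card (T a) \<le> card (T b)"
    using ex_has_least_nat[of "\<lambda>a. a \<in> J - I" a0 "\<lambda>a. card (T a)"] by blast
  have aA: "a \<in> carrier A" using a JA by blast
  obtain u0 where u0: "u0 \<in> T a"
    using a aA mem_I_iff[of a] unfolding T_def by blast
  have "T a \<subseteq> {u0}"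
  proof (rule ccontr)
    assume "\<not> T a \<subseteq> {u0}"
    then obtain v0 where v0: "v0 \<in> T a" "v0 \<noteq> u0" by blast
    then obtain l r where "(l @ u0 @ r \<in> L) \<noteq> (l @ v0 @ r \<in> L)"
      using separate[of u0 v0] u0 unfolding T_def by blast
    \<comment> \<open>Of \<open>u0\<close> and \<open>v0\<close>, the context admits
      \<open>u\<close> and rejects \<open>v\<close>.\<close>
    then obtain u v where uv: "u \<in> T a" "v \<in> T a" "l @ u @ r \<in> L" "l @ v @ r \<notin> L"
      using u0 v0 by blast
    have "l \<in> L" "r \<in> L"
      using factor_closed[OF uv(3)] by (auto simp: sublist_append)
    then have lr: "l \<in> lists {..<d}" "r \<in> lists {..<d}" using L_in_lists by blast+
    define b where "b = monomial F \<one> l \<otimes>\<^bsub>A\<^esub> (a \<otimes>\<^bsub>A\<^esub> monomial F \<one> r)"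
    have bJ: "b \<in> J"
      unfolding b_def using a lr by (intro J.I_l_closed J.I_r_closed monomial_closed) auto
    have arA: "a \<otimes>\<^bsub>A\<^esub> monomial F \<one> r \<in> carrier A"
      using aA lr by (intro A.m_closed monomial_closed) auto
    have "b (l @ u @ r) = (a \<otimes>\<^bsub>A\<^esub> monomial F \<one> r) (u @ r)"
      unfolding b_def using coeff_mult_monomial_left[OF arA one_closed, of l "u @ r"] arA by simp
    also have "\<dots> = a u" using coeff_mult_monomial_right[OF aA one_closed, of r u] aA by simp
    finally have "b (l @ u @ r) \<noteq> \<zero>" using uv(1) unfolding T_def by simp
    then have "b \<notin> I" using uv(3) unfolding mem_I_iff by blast
    then have "card (T a) \<le> card (T b)" using bJ min by blast
    \<comment> \<open>The words of \<open>b\<close> in \<open>L\<close> are of the form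
      \<open>l @ z @ r\<close> with \<open>z\<close> in \<open>T a\<close>, and \<open>z = v\<close>
      is impossible. So \<open>b\<close> has fewer words in \<open>L\<close> than \<open>a\<close>,
      against minimality.\<close>
    moreover have "T b \<subseteq> (\<lambda>z. l @ z @ r) ` (T a - {v})"
    proof
      fix w assume w: "w \<in> T b"
      then obtain x y where xy: "w = x @ y" "monomial F \<one> l x \<noteq> \<zero>" "(a \<otimes>\<^bsub>A\<^esub> monomial F \<one> r) y \<noteq> \<zero>"
        using coeff_mult_nonzero[of "monomial F \<one> l" "a \<otimes>\<^bsub>A\<^esub> monomial F \<one> r" w] arA lr monomial_closed
        unfolding T_def b_def by auto
      then obtain z t where zt: "y = z @ t" "a z \<noteq> \<zero>" "monomial F \<one> r t \<noteq> \<zero>"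
        using coeff_mult_nonzero[of a "monomial F \<one> r" y] aA lr monomial_closed by auto
      have eq: "w = l @ z @ r" using xy zt by (auto simp: monomial_def split: if_splits)
      then have "z \<in> L" using w factor_closed unfolding T_def by blast
      moreover have "z \<noteq> v" using eq w uv unfolding T_def by blast
      ultimately show "w \<in> (\<lambda>z. l @ z @ r) ` (T a - {v})"
        using eq zt unfolding T_def by blast
    qed
    then have "card (T b) \<le> card (T a - {v})"
      using fin[OF aA] by (intro surj_card_le) auto
    moreover have "card (T a - {v}) < card (T a)"
      using fin[OF aA] uv(2) by (rule card_Diff1_less)
    ultimately show False by linarith
  qed
  then have Ta: "\<And>w. w \<in> L \<Longrightarrow> w \<noteq> u0 \<Longrightarrow> a w = \<zero>" unfolding T_def by blast
  have u0': "u0 \<in> L" "a u0 \<noteq> \<zero>" using u0 unfolding T_def by auto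
  \<comment> \<open>On \<open>L\<close> the element \<open>a\<close> agrees with its monomial at
    \<open>u0\<close>, so the two differ by an element of \<open>I\<close>. The monomial is then in
    \<open>J\<close>, and its coefficient is invertible.\<close>
  let ?m = "monomial F (a u0) u0"
  have mA: "?m \<in> carrier A" using aA u0' L_in_lists by (intro monomial_closed) auto
  have "a \<ominus>\<^bsub>A\<^esub> ?m \<in> I"
    unfolding mem_I_iff using aA mA Ta by (auto simp: monomial_def a_minus_def r_neg)
  then have "a \<ominus>\<^bsub>A\<^esub> ?m \<in> J" using \<open>I \<subset> J\<close> by blast
  then have "a \<ominus>\<^bsub>A\<^esub> (a \<ominus>\<^bsub>A\<^esub> ?m) \<in> J"
    unfolding a_minus_def[of _ a "a \<ominus>\<^bsub>A\<^esub> ?m"] using a by (intro J.a_closed J.a_inv_closed) auto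
  moreover have "a \<ominus>\<^bsub>A\<^esub> (a \<ominus>\<^bsub>A\<^esub> ?m) = ?m"
  proof
    fix w show "(a \<ominus>\<^bsub>A\<^esub> (a \<ominus>\<^bsub>A\<^esub> ?m)) w = ?m w"
    proof -
      have "a w \<in> carrier F" "?m w \<in> carrier F" using aA mA by auto
      then have "a w \<ominus> (a w \<ominus> ?m w) = ?m w" by algebra
      then show ?thesis using aA mA by (subst coeff_minus) (simp_all add: coeff_minus)
    qed
  qed
  ultimately have "?m \<in> J" by simp
  then have "monomial F (inv (a u0)) [] \<otimes>\<^bsub>A\<^esub> ?m \<in> J"
    using aA u0' by (intro J.I_l_closed monomial_closed) (auto simp: field_Units)
  moreover have "monomial F (inv (a u0)) [] \<otimes>\<^bsub>A\<^esub> ?m = monomial F \<one> u0"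
    using aA u0' L_in_lists by (subst monomial_mult) (auto simp: field_Units)
  ultimately show ?thesis using u0'(1) by auto
qed

text \<open>For \<open>N\<close> a recurrence bound of a word \<open>u\<close> whose monomial is in
  \<open>J\<close>, the \<open>N\<close>th power of \<open>letter_sum\<close> is a combination of
  words of length \<open>N\<close>. Such a word either contains \<open>u\<close>, or lies outside
  \<open>L\<close> and so gives an element of \<open>I\<close>.\<close>

lemma ideal_contains_letter_sum_pow:
  assumes J: "ideal J A" and "I \<subset> J"
  shows "\<exists>n::nat. letter_sum [^]\<^bsub>A\<^esub> n \<in> J"
proof -
  interpret J: ideal J A by (rule J)
  obtain u where u: "u \<in> L" "monomial F \<one> u \<in> J" using ideal_contains_word assms by blast
  obtain N where N: "\<And>w. w \<in> L \<Longrightarrow> N \<le> length w \<Longrightarrow> sublist u w" using recurrent[OF u(1)] by blast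
  let ?b = "letter_sum [^]\<^bsub>A\<^esub> N"
  have bA: "?b \<in> carrier A" using letter_sum_closed by simp
  have "?b \<in> J"
  proof (rule mem_if_monomials[OF bA])
    fix w assume w: "?b w \<noteq> \<zero>"
    then have len: "length w = N" and wd: "w \<in> lists {..<d}"
      using letter_sum_pow bA unfolding free_carrier_iff by blast+
    have "monomial F \<one> w \<in> J"
    proof (cases "w \<in> L")
      case True
      then obtain l r where lr: "w = l @ u @ r" using N len unfolding sublist_def by blast
      then have "monomial F \<one> l \<otimes>\<^bsub>A\<^esub> (monomial F \<one> u \<otimes>\<^bsub>A\<^esub> monomial F \<one> r) \<in> J"
        using u wd by (intro J.I_l_closed J.I_r_closed monomial_closed) auto
      moreover have "monomial F \<one> l \<otimes>\<^bsub>A\<^esub> (monomial F \<one> u \<otimes>\<^bsub>A\<^esub> monomial F \<one> r) = monomial F \<one> w"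
        using wd lr by (simp add: monomial_mult)
      ultimately show ?thesis by simp
    next
      case False
      then show ?thesis using monomial_mem_I wd \<open>I \<subset> J\<close> by blast
    qed
    then show "monomial F (?b w) w \<in> J"
      using monomial_mem_ideal[OF J] wd bA by simp
  qed (auto intro: J.a_closed)
  then show ?thesis by blast
qed

text \<open>The criterion \<open>left_primitiveI\<close> is applied to the image of
  \<open>letter_sum\<close>. A left inverse lifts to the free algebra modulo \<open>I\<close> and
  would make \<open>L\<close> finite; a nonzero ideal pulls back to an ideal strictly above
  \<open>I\<close>.\<close>

theorem left_primitive_monomial_algebra: "left_primitive B"
proof (rule \<pi>.S.left_primitiveI)
  show "\<pi> letter_sum \<in> carrier B" using letter_sum_closed by simp
  show "a \<otimes>\<^bsub>B\<^esub> (\<one>\<^bsub>B\<^esub> \<ominus>\<^bsub>B\<^esub> \<pi> letter_sum) \<noteq> \<one>\<^bsub>B\<^esub>" if a: "a \<in> carrier B" for a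
  proof
    assume *: "a \<otimes>\<^bsub>B\<^esub> (\<one>\<^bsub>B\<^esub> \<ominus>\<^bsub>B\<^esub> \<pi> letter_sum) = \<one>\<^bsub>B\<^esub>"
    obtain p where p: "p \<in> carrier A" "a = \<pi> p" using \<pi>_surj[OF a] by blast
    have "\<pi> (p \<otimes>\<^bsub>A\<^esub> (\<one>\<^bsub>A\<^esub> \<ominus>\<^bsub>A\<^esub> letter_sum)) = \<pi> \<one>\<^bsub>A\<^esub>"
      using * p letter_sum_closed by (simp add: a_minus_def)
    then have "p \<otimes>\<^bsub>A\<^esub> (\<one>\<^bsub>A\<^esub> \<ominus>\<^bsub>A\<^esub> letter_sum) \<ominus>\<^bsub>A\<^esub> \<one>\<^bsub>A\<^esub> \<in> I"
      using p letter_sum_closed by (subst (asm) \<pi>_eq_iff) auto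
    then show False using one_minus_letter_sum_not_left_invertible p(1) infinite_L by blast
  qed
  show "\<exists>n::nat. \<pi> letter_sum [^]\<^bsub>B\<^esub> n \<in> Q" if Q: "ideal Q B" "Q \<noteq> {\<zero>\<^bsub>B\<^esub>}" for Q
  proof -
    interpret Q: ideal Q B by (rule Q)
    let ?J = "{p \<in> carrier A. \<pi> p \<in> Q}"
    have "I \<subseteq> ?J"
    proof
      fix p assume p: "p \<in> I"
      then have "\<pi> p = \<zero>\<^bsub>B\<^esub>" "p \<in> carrier A" using \<pi>_eq_zero_iff mem_I_iff by blast+
      then show "p \<in> ?J" using Q.zero_closed by simp
    qed
    moreover obtain x where x: "x \<in> Q" "x \<noteq> \<zero>\<^bsub>B\<^esub>" using Q(2) Q.zero_closed by blast
    then obtain p where "p \<in> carrier A" "x = \<pi> p" using \<pi>_surj Q.a_subset by blast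
    then have "p \<in> ?J - I" using x \<pi>_eq_zero_iff by blast
    ultimately have "I \<subset> ?J" by blast
    then obtain n :: nat where "letter_sum [^]\<^bsub>A\<^esub> n \<in> ?J"
      using ideal_contains_letter_sum_pow[OF \<pi>.ideal_vimage[OF Q(1)]] by blast
    then show ?thesis using letter_sum_closed by (auto simp: \<pi>.hom_nat_pow)
  qed
qed

end

section \<open>Scalars, the basis of words and the length filtration\<close>

context monomial_algebra_field
begin

definition K :: "(nat list \<Rightarrow> 'a) set set" where
  "K = monomial_algebra_scalars F d (lists {..<d} - L)"

lemma K_eq: "K = (\<lambda>c. \<pi> (monomial F c [])) ` carrier F"
  by (simp add: K_def monomial_algebra_scalars_def I_def monomial_def)

lemma monomial_Nil_mult:
  assumes "c \<in> carrier F" "p \<in> carrier A"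
  shows "(monomial F c [] \<otimes>\<^bsub>A\<^esub> p) w = c \<otimes> p w" "(p \<otimes>\<^bsub>A\<^esub> monomial F c []) w = c \<otimes> p w"
  using coeff_mult_monomial_left[OF assms(2,1), of "[]" w]
    coeff_mult_monomial_right[OF assms(2,1), of "[]" w] assms by (auto simp: m_comm)

lemma B_one_neq_zero: "\<one>\<^bsub>B\<^esub> \<noteq> \<zero>\<^bsub>B\<^esub>"
proof
  assume "\<one>\<^bsub>B\<^esub> = \<zero>\<^bsub>B\<^esub>"
  then have "\<one>\<^bsub>A\<^esub> \<in> I" using \<pi>_eq_zero_iff[of "\<one>\<^bsub>A\<^esub>"] by simp
  then show False using Nil_in_L unfolding mem_I_iff free_one by (auto simp: monomial_def)
qed

lemma subfield_K: "subfield K B"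
proof -
  interpret h: ring_hom_ring F B "\<lambda>c. \<pi> (monomial F c [])"
  proof (rule ring_hom_ringI[OF F.ring_axioms \<pi>.S.ring_axioms])
    fix c c' assume c: "c \<in> carrier F" "c' \<in> carrier F"
    have "monomial F (c \<oplus> c') [] = monomial F c [] \<oplus>\<^bsub>A\<^esub> monomial F c' []"
      using c by (auto simp: monomial_def)
    then show "\<pi> (monomial F (c \<oplus> c') []) = \<pi> (monomial F c []) \<oplus>\<^bsub>B\<^esub> \<pi> (monomial F c' [])"
      using c by (simp add: monomial_closed)
    have "monomial F (c \<otimes> c') [] = monomial F c [] \<otimes>\<^bsub>A\<^esub> monomial F c' []"
      using c by (simp add: monomial_mult)
    then show "\<pi> (monomial F (c \<otimes> c') []) = \<pi> (monomial F c []) \<otimes>\<^bsub>B\<^esub> \<pi> (monomial F c' [])"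
      using c by (simp add: monomial_closed)
  qed (auto simp: monomial_closed simp flip: free_one)
  show ?thesis
    unfolding K_eq by (rule h.img_is_subfield(2)[OF carrier_is_subfield B_one_neq_zero])
qed

text \<open>Only the coefficients on \<open>L\<close> are restricted, because the words outside
  \<open>L\<close> vanish in the quotient.\<close>

definition span_words :: "nat list set \<Rightarrow> (nat list \<Rightarrow> 'a) set set" where
  "span_words S = \<pi> ` {p \<in> carrier A. \<forall>w\<in>L. p w \<noteq> \<zero> \<longrightarrow> w \<in> S}"

text \<open>A new word \<open>u\<close> of \<open>L\<close> extends the space by a line. Its image
  is not in the old space: the coefficients at \<open>u\<close> are \<open>\<one>\<close> and
  \<open>\<zero>\<close>, and elements of \<open>I\<close> vanish at \<open>u\<close>.\<close>

lemma dimension_span_words: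
  assumes "finite S" "S \<subseteq> L"
  shows "\<pi>.S.dimension (card S) K (span_words S)"
  using assms
proof (induction S rule: finite_induct)
  case empty
  have "span_words {} = \<pi> ` I" unfolding span_words_def mem_I_iff[abs_def] by (auto simp: mem_I_iff)
  also have "\<dots> = {\<zero>\<^bsub>B\<^esub>}"
  proof -
    have "\<pi> p = \<zero>\<^bsub>B\<^esub>" if "p \<in> I" for p using that \<pi>_eq_zero_iff mem_I_iff by blast
    then show ?thesis using I.zero_closed by blast
  qed
  finally show ?case by simp
next
  case (insert u S)
  let ?m = "monomial F \<one> u"
  have u: "u \<in> L" "u \<in> lists {..<d}" using insert.prems L_in_lists by auto
  have mA: "?m \<in> carrier A" using u by (simp add: monomial_closed)
  have "\<pi> ?m \<notin> span_words S"
  proof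
    assume "\<pi> ?m \<in> span_words S"
    then obtain p where p: "p \<in> carrier A" "\<And>w. w \<in> L \<Longrightarrow> p w \<noteq> \<zero> \<Longrightarrow> w \<in> S" "\<pi> ?m = \<pi> p"
      unfolding span_words_def by blast
    then have "?m \<ominus>\<^bsub>A\<^esub> p \<in> I" using \<pi>_eq_iff mA by blast
    then have "(?m \<ominus>\<^bsub>A\<^esub> p) u = \<zero>" using u unfolding mem_I_iff by blast
    moreover have "p u = \<zero>" using p(2) u insert.hyps by blast
    ultimately show False using mA p(1) by (simp add: monomial_def)
  qed
  then have "\<pi>.S.dimension (Suc (card S)) K (\<pi>.S.line_extension K (\<pi> ?m) (span_words S))"
    using insert mA by (intro \<pi>.S.dimension.Suc_dim) auto
  moreover have "\<pi>.S.line_extension K (\<pi> ?m) (span_words S) = span_words (insert u S)"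
  proof (intro equalityI subsetI)
    fix x assume "x \<in> \<pi>.S.line_extension K (\<pi> ?m) (span_words S)"
    then obtain c p where cp: "c \<in> carrier F" "p \<in> carrier A" "\<And>w. w \<in> L \<Longrightarrow> p w \<noteq> \<zero> \<Longrightarrow> w \<in> S"
      "x = \<pi> (monomial F c []) \<otimes>\<^bsub>B\<^esub> \<pi> ?m \<oplus>\<^bsub>B\<^esub> \<pi> p"
      unfolding \<pi>.S.line_extension_mem_iff K_eq span_words_def by blast
    then have "x = \<pi> (monomial F c [] \<otimes>\<^bsub>A\<^esub> ?m \<oplus>\<^bsub>A\<^esub> p)"
      using mA by (simp add: monomial_closed)
    moreover have "monomial F c [] \<otimes>\<^bsub>A\<^esub> ?m = monomial F c u"
      using cp u by (simp add: monomial_mult)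
    moreover have "w \<in> insert u S" if "w \<in> L" "(monomial F c u \<oplus>\<^bsub>A\<^esub> p) w \<noteq> \<zero>" for w
      using that cp by (cases "w = u") (auto simp: monomial_def)
    moreover have "monomial F c u \<oplus>\<^bsub>A\<^esub> p \<in> carrier A"
      using cp u by (simp add: monomial_closed)
    ultimately show "x \<in> span_words (insert u S)" unfolding span_words_def by auto
  next
    fix x assume "x \<in> span_words (insert u S)"
    then obtain p where p: "p \<in> carrier A" "\<And>w. w \<in> L \<Longrightarrow> p w \<noteq> \<zero> \<Longrightarrow> w \<in> insert u S" "x = \<pi> p"
      unfolding span_words_def by blast
    let ?q = "(\<lambda>w. if w = u then \<zero> else p w)"
    have q: "?q \<in> carrier A"
      using p(1) by (auto simp: free_carrier_iff elim: rev_finite_subset)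
    have "p = monomial F (p u) [] \<otimes>\<^bsub>A\<^esub> ?m \<oplus>\<^bsub>A\<^esub> ?q"
      using p(1) u by (auto simp: monomial_mult) (auto simp: monomial_def)
    moreover have kA: "monomial F (p u) [] \<in> carrier A" using p(1) by (simp add: monomial_closed)
    ultimately have "x = \<pi> (monomial F (p u) [] \<otimes>\<^bsub>A\<^esub> ?m \<oplus>\<^bsub>A\<^esub> ?q)" using p(3) by simp
    also have "\<dots> = \<pi> (monomial F (p u) []) \<otimes>\<^bsub>B\<^esub> \<pi> ?m \<oplus>\<^bsub>B\<^esub> \<pi> ?q"
      using q mA kA by (simp only: \<pi>.hom_add \<pi>.hom_mult A.m_closed)
    finally have "x = \<pi> (monomial F (p u) []) \<otimes>\<^bsub>B\<^esub> \<pi> ?m \<oplus>\<^bsub>B\<^esub> \<pi> ?q" .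
    moreover have "\<pi> ?q \<in> span_words S" unfolding span_words_def using q p(2) by (intro imageI) auto
    moreover have "\<pi> (monomial F (p u) []) \<in> K" unfolding K_eq using p(1) by auto
    ultimately show "x \<in> \<pi>.S.line_extension K (\<pi> ?m) (span_words S)"
      unfolding \<pi>.S.line_extension_mem_iff by blast
  qed
  ultimately show ?case using insert.hyps by simp
qed

definition E :: "nat \<Rightarrow> (nat list \<Rightarrow> 'a) set set" where
  "E n = span_words {w \<in> L. length w \<le> n}"

lemma E_eq: "E n = \<pi> ` {p \<in> carrier A. \<forall>w\<in>L. p w \<noteq> \<zero> \<longrightarrow> length w \<le> n}"
  unfolding E_def span_words_def by (rule arg_cong[of _ _ "image \<pi>"]) auto

lemma dimension_E: "\<pi>.S.dimension (card {w \<in> L. length w \<le> n}) K (E n)"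
  unfolding E_def by (rule dimension_span_words) (auto simp: finite_length_le)

lemma \<pi>_monomial_in_E:
  assumes "c \<in> carrier F" "u \<in> lists {..<d}" "length u \<le> n"
  shows "\<pi> (monomial F c u) \<in> E n"
  unfolding E_eq using assms monomial_closed by (auto simp: monomial_def split: if_splits)

text \<open>The filtration is multiplicative because a word of \<open>L\<close> in a product splits
  into two words, again in \<open>L\<close>, to which the length bounds apply. It is generated in
  degree one because the last letter of a word can be split off.\<close>

sublocale filtered: filtered_algebra "monomial_algebra F d (lists {..<d} - L)" K E
proof (intro filtered_algebra.intro filtered_algebra_axioms.intro)
  show "ring B" by (rule \<pi>.S.ring_axioms)
  show "subfield K B" by (rule subfield_K)
  show "x \<otimes>\<^bsub>B\<^esub> k = k \<otimes>\<^bsub>B\<^esub> x" if k: "k \<in> K" and x: "x \<in> carrier B" for k x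
  proof -
    obtain c p where cp: "c \<in> carrier F" "k = \<pi> (monomial F c [])" "p \<in> carrier A" "x = \<pi> p"
      using \<pi>_surj[OF x] k unfolding K_eq by blast
    have "p \<otimes>\<^bsub>A\<^esub> monomial F c [] = monomial F c [] \<otimes>\<^bsub>A\<^esub> p"
      using cp by (auto simp: monomial_Nil_mult)
    then show ?thesis using cp by (metis \<pi>.hom_mult Nil_in_L L_in_lists monomial_closed)
  qed
  show fin: "\<pi>.S.finite_dimension K (E n)" for n
    using dimension_E by (rule \<pi>.S.finite_dimensionI)
  show "subalgebra K (E n) B" for n
    using \<pi>.S.finite_dimension_imp_subalgebra[OF subfield_K fin] .
  then have sub: "subgroup (E n) (add_monoid B)" for n
    by (rule subalgebra.axioms(1))
  show "E m \<subseteq> E n" if "m \<le> n" for m n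
    unfolding E_eq using that by (intro image_mono) auto
  show "E 0 = K"
  proof (intro equalityI subsetI)
    fix x assume "x \<in> E 0"
    then obtain p where p: "p \<in> carrier A" "\<And>w. w \<in> L \<Longrightarrow> p w \<noteq> \<zero> \<Longrightarrow> w = []" "x = \<pi> p"
      unfolding E_eq by auto
    have mA: "monomial F (p []) [] \<in> carrier A" using p by (simp add: monomial_closed)
    have "p \<ominus>\<^bsub>A\<^esub> monomial F (p []) [] \<in> I"
      unfolding mem_I_iff using p mA by (auto simp: monomial_def a_minus_def r_neg)
    then have "x = \<pi> (monomial F (p []) [])" using \<pi>_eq_iff p mA by blast
    then show "x \<in> K" unfolding K_eq using p(1) by auto
  next
    fix x assume "x \<in> K"
    then show "x \<in> E 0" unfolding K_eq using \<pi>_monomial_in_E by auto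
  qed
  show "x \<otimes>\<^bsub>B\<^esub> y \<in> E (m + n)" if "x \<in> E m" "y \<in> E n" for x y m n
  proof -
    obtain p q where p: "p \<in> carrier A" "\<And>w. w \<in> L \<Longrightarrow> p w \<noteq> \<zero> \<Longrightarrow> length w \<le> m" "x = \<pi> p"
      and q: "q \<in> carrier A" "\<And>w. w \<in> L \<Longrightarrow> q w \<noteq> \<zero> \<Longrightarrow> length w \<le> n" "y = \<pi> q"
      using \<open>x \<in> E m\<close> \<open>y \<in> E n\<close> unfolding E_eq by blast
    have "length w \<le> m + n" if w: "w \<in> L" "(p \<otimes>\<^bsub>A\<^esub> q) w \<noteq> \<zero>" for w
    proof -
      obtain u v where uv: "w = u @ v" "p u \<noteq> \<zero>" "q v \<noteq> \<zero>"
        using coeff_mult_nonzero[OF p(1) q(1) w(2)] by blast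
      then have "u \<in> L" "v \<in> L" using factor_closed[OF w(1)] by auto
      then show ?thesis using p(2) q(2) uv by (simp add: add_mono)
    qed
    moreover have "x \<otimes>\<^bsub>B\<^esub> y = \<pi> (p \<otimes>\<^bsub>A\<^esub> q)" using p q by simp
    ultimately show ?thesis unfolding E_eq using p(1) q(1) by blast
  qed
  show "\<exists>n. x \<in> E n" if x: "x \<in> carrier B" for x
  proof -
    obtain p where p: "p \<in> carrier A" "x = \<pi> p" using \<pi>_surj[OF x] by blast
    then have "finite (length ` supp p)" by (simp add: free_carrier_iff)
    then obtain n where "\<And>w. p w \<noteq> \<zero> \<Longrightarrow> length w \<le> n"
      using finite_nat_set_iff_bounded_le by auto
    then show ?thesis unfolding E_eq using p by blast
  qed
  show "E (Suc n) \<subseteq> generate (add_monoid B) (E n <#>\<^bsub>B\<^esub> E 1)" for n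
  proof
    let ?G = "generate (add_monoid B) (E n <#>\<^bsub>B\<^esub> E 1)"
    have E_carr: "E n \<subseteq> carrier B" for n using subgroup.subset[OF sub] by simp
    have "E n <#>\<^bsub>B\<^esub> E 1 \<subseteq> carrier B" using E_carr by (fastforce simp: set_mult_def)
    then have G: "subgroup ?G (add_monoid B)" by (rule \<pi>.S.add.generate_is_subgroup)
    fix x assume "x \<in> E (Suc n)"
    then obtain p where p: "p \<in> carrier A" "\<And>w. w \<in> L \<Longrightarrow> p w \<noteq> \<zero> \<Longrightarrow> length w \<le> Suc n" "x = \<pi> p"
      unfolding E_eq by blast
    have "p \<in> {q \<in> carrier A. \<pi> q \<in> ?G}"
    proof (rule mem_if_monomials[OF p(1)])
      show "\<zero>\<^bsub>A\<^esub> \<in> {q \<in> carrier A. \<pi> q \<in> ?G}"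
        using subgroup.one_closed[OF G] by simp
      show "q \<oplus>\<^bsub>A\<^esub> q' \<in> {q \<in> carrier A. \<pi> q \<in> ?G}"
        if "q \<in> {q \<in> carrier A. \<pi> q \<in> ?G}" "q' \<in> {q \<in> carrier A. \<pi> q \<in> ?G}" for q q'
        using that \<pi>.S.add.subgroupE(4)[OF G] by simp
      fix w assume w: "p w \<noteq> \<zero>"
      then have wd: "w \<in> lists {..<d}" and pw: "p w \<in> carrier F"
        using p(1) unfolding free_carrier_iff by auto
      have mA: "monomial F (p w) w \<in> carrier A" using wd pw by (simp add: monomial_closed)
      have "\<pi> (monomial F (p w) w) \<in> ?G"
      proof (cases "w \<in> L")
        case True
        \<comment> \<open>A nonempty \<open>w\<close> gives up its last letter; the empty word
          splits into two empty words, whence the bound \<open>length v \<le> 1\<close>.\<close>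
        have "\<exists>u v. w = u @ v \<and> length u \<le> n \<and> length v \<le> 1"
        proof (cases w rule: rev_cases)
          case (snoc u y)
          then show ?thesis using p(2)[OF True w] by (intro exI[of _ u] exI[of _ "[y]"]) simp
        qed simp
        then obtain u v where uv: "w = u @ v" "length u \<le> n" "length v \<le> 1" by blast
        then have uvd: "u \<in> lists {..<d}" "v \<in> lists {..<d}" using wd by auto
        have "\<pi> (monomial F (p w) w) = \<pi> (monomial F (p w) u \<otimes>\<^bsub>A\<^esub> monomial F \<one> v)"
          using uvd pw uv(1) by (simp add: monomial_mult)
        also have "\<dots> = \<pi> (monomial F (p w) u) \<otimes>\<^bsub>B\<^esub> \<pi> (monomial F \<one> v)"
          using uvd pw by (intro \<pi>.hom_mult monomial_closed) auto
        also have "\<dots> \<in> E n <#>\<^bsub>B\<^esub> E 1"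
          using \<pi>_monomial_in_E[OF pw uvd(1) uv(2)] \<pi>_monomial_in_E[OF one_closed uvd(2) uv(3)]
          unfolding set_mult_def by blast
        finally show ?thesis by (rule generate.incl)
      next
        case False
        then have "\<pi> (monomial F (p w) w) = \<zero>\<^bsub>B\<^esub>"
          using \<pi>_eq_zero_iff[OF mA] monomial_mem_I[OF pw wd] by blast
        then show ?thesis using subgroup.one_closed[OF G] by simp
      qed
      then show "monomial F (p w) w \<in> {q \<in> carrier A. \<pi> q \<in> ?G}" using mA by blast
    qed
    then show "x \<in> ?G" using p(3) by blast
  qed
qed

lemma dim_E: "ring.dim B K (E n) = card {w \<in> L. length w \<le> n}"
  using \<pi>.S.dimI[OF subfield_K dimension_E] by (simp add: over_def)

text \<open>\<open>growth_function_bounds\<close> compares the growth for any \<open>V\<close> with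
  the number of words of \<open>L\<close>, and the assumptions compare that number with
  \<open>f\<close>. The equivalence composes the two.\<close>

theorem has_growth_type_monomial_algebra:
  assumes "c \<ge> 1"
    and upper: "\<And>n. n \<ge> 1 \<Longrightarrow> card {w \<in> L. length w \<le> n} \<le> f (c * n)"
    and lower: "\<And>n. n \<ge> 1 \<Longrightarrow> f n \<le> card {w \<in> L. length w \<le> 2 * n}"
  shows "has_growth_type B K f"
  unfolding has_growth_type_def
proof (intro conjI allI impI)
  show "\<exists>V. fd_generating_subspace B K V" using filtered.fd_generating_E_one by blast
  fix V assume V: "fd_generating_subspace B K V"
  obtain s where s: "s \<ge> 1"
    "\<And>n. growth_function B K V n \<le> card {w \<in> L. length w \<le> s * n}"
    "\<And>n. card {w \<in> L. length w \<le> n} \<le> growth_function B K V (s * n)"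
    using filtered.growth_function_bounds[OF V] unfolding over_def dim_E by blast
  show "growth_equiv (growth_function B K V) f"
    unfolding growth_equiv_def
  proof (intro exI conjI allI impI)
    fix n :: nat assume n: "n \<ge> 1"
    \<comment> \<open>The constants of the equivalence are \<open>c * s\<close> and
      \<open>s * 2 * c * s\<close>: each passage between growth function and word count costs
      \<open>s\<close>, and those between word count and \<open>f\<close> cost \<open>c\<close> and
      \<open>2\<close>.\<close>
    show "growth_function B K V n \<le> f (c * s * n)"
      using order.trans[OF s(2) upper[of "s * n"]] s(1) n by (simp add: mult.assoc)
    show "f (c * s * n) \<le> growth_function B K V (s * 2 * c * s * n)"
      using order.trans[OF lower[of "c * s * n"] s(3)] s(1) n \<open>c \<ge> 1\<close> by (simp add: mult.assoc)
  qed (use s(1) \<open>c \<ge> 1\<close> in auto)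
qed

end

section \<open>Primitive monomial algebras of prescribed growth\<close>

theorem theorem1p3:
  fixes F :: "('a, 'b) ring_scheme" and f :: "nat \<Rightarrow> nat"
  assumes "field F"
    and positive: "\<forall>n\<ge>1. f n \<ge> 1"
    and monotone: "\<forall>n\<ge>1. f n \<le> f (n + 1)"
    and submultiplicative: "\<forall>m\<ge>1. \<forall>n\<ge>1. f (m + n) \<le> f m * f n"
    and "\<exists>C\<ge>1. \<forall>n\<ge>1. f (C * n) \<ge> n * f n"
  shows "\<exists>d W. W \<subseteq> lists {..<d} \<and>
           left_primitive (monomial_algebra F d W) \<and>
           has_growth_type (monomial_algebra F d W) (monomial_algebra_scalars F d W) f"
proof -
  obtain C where C: "C \<ge> 1" "\<forall>n\<ge>1. f (C * n) \<ge> n * f n" using assms(5) by blast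
  obtain d L c where L: "recurrent_language d L" and "c \<ge> 1"
    and bounds: "\<forall>n\<ge>1. card {w \<in> L. length w \<le> n} \<le> f (c * n) \<and> f n \<le> card {w \<in> L. length w \<le> 2 * n}"
    using ex_recurrent_language[OF positive monotone submultiplicative C] by blast
  interpret recurrent_language d L by (rule L)
  interpret field F by (rule \<open>field F\<close>)
  interpret recurrent_monomial_algebra F d L ..
  show ?thesis
  proof (intro exI conjI)
    \<comment> \<open>All words outside \<open>L\<close> serve as relations, so the nonzero words
      are those of \<open>L\<close>.\<close>
    show "lists {..<d} - L \<subseteq> lists {..<d}" by blast
    show "left_primitive B" by (rule left_primitive_monomial_algebra)
    show "has_growth_type B (monomial_algebra_scalars F d (lists {..<d} - L)) f"
      unfolding K_def[symmetric] using \<open>c \<ge> 1\<close> bounds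
      by (intro has_growth_type_monomial_algebra[of c]) auto
  qed
qed

end
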